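(* Consider Algorithm 4 (described in the context) with a fixed number $T$ of packet processing stages. Assume that $\chi_t^{(\ell)}$, $\ell=1,2$, are normally distributed with mathematical expectations and variances given by $$\mathbb E\,\chi_t^{(\ell)}=Mp_{t-1}^{(\ell)}q_\ell,\qquad \mathrm{Var}\,\chi_t^{(\ell)}=Mp_{t-1}^{(\ell)}q_\ell\left(1-p_{t-1}^{(\ell)}q_\ell\right),\qquad \ell=1,2.$$ Then asymptotically (as $N\to\infty$) the normalized loss function $\mathrm L_N^{(4)}(\beta,p,d)$ does not depend on $N$, $M$, but does depend on $q$, $D$ and the parameters of packet processing.
   Context: Gibbs distribution: for $\beta'>0$ and $\overline\zeta=(\zeta^{(1)},\zeta^{(2)})\in\mathbb R^2$, $$\overline G_{\beta'}(\overline\zeta)=\frac{1}{e^{-\zeta^{(1)}/\beta'}+e^{-\zeta^{(2)}/\beta'}}\left(e^{-\zeta^{(1)}/\beta'},\,e^{-\zeta^{(2)}/\beta'}\right).$$ Setting (Bernoulli two-armed bandit): $N=TM$ data items are processed in $T$ packets of size $M$. Action $y_n=\ell\in\{1,2\}$ applied to item $n$ yields income $\xi_n=1$ with probability $p_\ell$ and $\xi_n=0$ with probability $q_\ell=1-p_\ell$. Parameters: $D=0.25$ (the maximal possible variance of one-step income), $0<p<1$, $q=1-p$, $d>0$, $\beta>0$, and $p_1=p+d(D/N)^{1/2}$, $p_2=p-d(D/N)^{1/2}$, $\beta_t=\beta(DM(t+0.5))^{1/2}$. The parameters of packet processing are the number of stages $T$, equivalently $M/N=1/T$. Algorithm 4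 (a parallel version of the mirror descent algorithm). Start with $\overline p_0=(0.5,0.5)$, $\overline\zeta_0=(0,0)$. For $t=1,\dots,T$: for each item $n=(t-1)M+1,\dots,tM$ of the packet, draw an action $y_n$ with $\Pr(y_n=\ell)=p_{t-1}^{(\ell)}$, $\ell=1,2$ (these probabilities are fixed during the packet), apply it and get the income $\xi_n$; let $\chi_t^{(\ell)}$ be the sum of $1-\xi_n$ over the items of the packet with $y_n=\ell$. Then put $$\overline u_t=\left(\frac{\chi_t^{(1)}}{p_{t-1}^{(1)}},\frac{\chi_t^{(2)}}{p_{t-1}^{(2)}}\right),\qquad \overline\zeta_t=\overline\zeta_{t-1}+\overline u_t,\qquad \overline p_t=(p_t^{(1)},p_t^{(2)})=\overline G_{\beta_t}(\overline\zeta_t).$$ In the normality assumption, the expectations and variances are those given $\overline p_{t-1}$, and the normal fluctuations of $\chi_t^{(\ell)}$ around these expectations are treated as independent for $\ell=1,2$ and $t=1,\dots,T$. Normalized regret (normalized loss function): $\mathrm L_N^{(4)}(\beta,p,d)=(DN)^{-1/2}L_N$, where the regret $$L_N=N\max(p_1,p_2)-\mathbb E\left(\sum_{n=1}^N\xi_n\right)=(p_1-p_2)\sum_{t=1}^T M\,\mathbb E\left(p_{t-1}^{(2)}\right)$$ is the expected loss of total income of Algorithm 4 with respect to its maximal possible value. *)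

theory Defs
  imports "HOL-Probability.Probability"
begin

definition gibbs :: "real \<Rightarrow> real^2 \<Rightarrow> real^2" where
  "gibbs b z = (\<chi> l. exp (- (z $ l) / b) / (exp (- (z $ 1) / b) + exp (- (z $ 2) / b)))"

text \<open>\<open>D\<close> is the maximal variance \<open>1/4\<close> of a Bernoulli income. It is kept as a positive parameter,
  since dependence of the limiting loss on \<open>D\<close> has no meaning for a constant.
  \<open>N\<close> is the total number \<open>T * M\<close> of items.\<close>

definition arm_prob :: "real \<Rightarrow> real \<Rightarrow> real \<Rightarrow> nat \<Rightarrow> 2 \<Rightarrow> real" where
  "arm_prob p d D N l =
     (if l = 1 then p + d * sqrt (D / real N) else p - d * sqrt (D / real N))"

definition temperature :: "real \<Rightarrow> real \<Rightarrow> nat \<Rightarrow> nat \<Rightarrow> real" where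
  "temperature \<beta> D M t = \<beta> * sqrt (D * real M * (real t + 1/2))"

text \<open>The algorithm, driven by the packet losses \<open>x t\<close> (\<open>t = 1, 2, \<dots>\<close>), the component
  \<open>x t $ l\<close> being the sum of \<open>1 - \<xi>\<^sub>n\<close> over the items of packet \<open>t\<close> to which action \<open>l\<close>
  is applied. \<open>strategy \<beta> D M t \<zeta>\<close> is the vector of action probabilities used in packet
  \<open>t + 1\<close> when the accumulated estimate is \<open>\<zeta>\<close>.\<close>

definition strategy :: "real \<Rightarrow> real \<Rightarrow> nat \<Rightarrow> nat \<Rightarrow> real^2 \<Rightarrow> real^2" where
  "strategy \<beta> D M t z = (if t = 0 then (\<chi> l. 1/2) else gibbs (temperature \<beta> D M t) z)"

primrec zeta :: "real \<Rightarrow> real \<Rightarrow> nat \<Rightarrow> (nat \<Rightarrow> real^2) \<Rightarrow> nat \<Rightarrow> real^2" where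
  "zeta \<beta> D M x 0 = 0"
| "zeta \<beta> D M x (Suc t) =
     zeta \<beta> D M x t + (\<chi> l. x (Suc t) $ l / strategy \<beta> D M t (zeta \<beta> D M x t) $ l)"

definition action_prob :: "real \<Rightarrow> real \<Rightarrow> nat \<Rightarrow> (nat \<Rightarrow> real^2) \<Rightarrow> nat \<Rightarrow> real^2" where
  "action_prob \<beta> D M x t = strategy \<beta> D M t (zeta \<beta> D M x t)"

definition loss_mean :: "real \<Rightarrow> real \<Rightarrow> nat \<Rightarrow> real" where
  "loss_mean \<pi> q M = real M * \<pi> * q"

definition loss_var :: "real \<Rightarrow> real \<Rightarrow> nat \<Rightarrow> real" where
  "loss_var \<pi> q M = real M * \<pi> * q * (1 - \<pi> * q)"

text \<open>The normality assumption on the packet losses \<open>X t\<close>. Mean and variance depend on the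
  current, random, action probabilities, so they are conditional ones: the loss equals its mean
  plus its standard deviation times a standard normal fluctuation \<open>\<eta> t l\<close>, and the fluctuations
  of all actions and packets are independent. In particular \<open>\<eta> t l\<close> is independent of the action
  probabilities used in packet \<open>t\<close>, as these are determined by the fluctuations
  of the earlier packets.\<close>

definition normal_losses ::
  "real \<Rightarrow> real \<Rightarrow> real \<Rightarrow> real \<Rightarrow> nat \<Rightarrow> nat \<Rightarrow> 'a measure \<Rightarrow> (nat \<Rightarrow> 'a \<Rightarrow> real^2) \<Rightarrow> bool" where
  "normal_losses \<beta> p d D T M P X \<longleftrightarrow>
     prob_space P \<and>
     (\<forall>t\<in>{1..T}. X t \<in> borel_measurable P) \<and>
     (\<exists>\<eta> :: nat \<Rightarrow> 2 \<Rightarrow> 'a \<Rightarrow> real.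
        prob_space.indep_vars P (\<lambda>_. borel) (\<lambda>(t, l). \<eta> t l) ({1..T} \<times> UNIV) \<and>
        (\<forall>t\<in>{1..T}. \<forall>l. distributed P lborel (\<eta> t l) std_normal_density) \<and>
        (\<forall>t\<in>{1..T}. \<forall>l. AE \<omega> in P.
           let \<pi> = action_prob \<beta> D M (\<lambda>s. X s \<omega>) (t - 1) $ l;
               q = 1 - arm_prob p d D (T * M) l
           in X t \<omega> $ l = loss_mean \<pi> q M + sqrt (loss_var \<pi> q M) * \<eta> t l \<omega>))"

text \<open>Each item contributes its loss \<open>1 - \<xi>\<^sub>n\<close> to exactly one component of \<open>X t\<close>, so the income
  earned in packet \<open>t\<close> is \<open>M\<close> minus the sum of the components of \<open>X t\<close>.\<close>

definition total_income :: "nat \<Rightarrow> nat \<Rightarrow> (nat \<Rightarrow> 'a \<Rightarrow> real^2) \<Rightarrow> 'a \<Rightarrow> real" where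
  "total_income T M X \<omega> = (\<Sum>t = 1..T. real M - (X t \<omega> $ 1 + X t \<omega> $ 2))"

definition regret ::
  "real \<Rightarrow> real \<Rightarrow> real \<Rightarrow> nat \<Rightarrow> nat \<Rightarrow> 'a measure \<Rightarrow> (nat \<Rightarrow> 'a \<Rightarrow> real^2) \<Rightarrow> real" where
  "regret p d D T M P X =
     real (T * M) * max (arm_prob p d D (T * M) 1) (arm_prob p d D (T * M) 2)
       - (LINT \<omega>|P. total_income T M X \<omega>)"

definition normalized_regret ::
  "real \<Rightarrow> real \<Rightarrow> real \<Rightarrow> nat \<Rightarrow> nat \<Rightarrow> 'a measure \<Rightarrow> (nat \<Rightarrow> 'a \<Rightarrow> real^2) \<Rightarrow> real" where
  "normalized_regret p d D T M P X = regret p d D T M P X / sqrt (D * real (T * M))"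

end

theory Submission
  imports Defs
begin

text \<open>
  Divided by \<open>sqrt (D * M)\<close>, the difference \<open>\<zeta> $ 1 - \<zeta> $ 2\<close> is a random walk with drift \<open>- 2 * d / sqrt T\<close>,
  for every \<open>M\<close>, whose noise is a function of the current position, the step \<open>t\<close> and the two
  failure probabilities \<open>1 - p\<^sub>l\<close>. The normalized regret is \<open>2 * d / T\<close> times the sum of the
  expected probabilities of the second action. As \<open>M\<close> grows, both failure probabilities tend to \<open>q\<close>,
  and dominated convergence on one common space of normal noise gives the limit.

  Dependence on \<open>T\<close>: the limit is \<open>d\<close> for \<open>T = 1\<close>, and smaller for \<open>T = 2\<close>, since the negative drift
  makes the second action less likely than the first one. Dependence on \<open>q\<close> and \<open>D\<close>: as \<open>q / D\<close> tends
  to \<open>0\<close>, the walk becomes deterministic, and the limiting loss tends to the loss of the noiseless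
  walk; but for small positive \<open>q / D\<close> it is strictly larger, because the logistic function is strictly
  convex along the noiseless path.
\<close>

section \<open>Independent normal noise\<close>

definition gauss :: "real measure" where
  "gauss = density lborel std_normal_density"

text \<open>Coordinate \<open>(t, l)\<close> is the fluctuation of action \<open>l\<close> in packet
  \<open>t\<close>. The space does not involve \<open>M\<close>, so the regrets for all
  \<open>M\<close> become integrals over it and can be compared pathwise.\<close>

definition noise_space :: "nat \<Rightarrow> (nat \<times> 2 \<Rightarrow> real) measure" where
  "noise_space T = PiM ({1..T} \<times> UNIV) (\<lambda>_. gauss)"

lemma sets_gauss [simp, measurable_cong]: "sets gauss = sets borel"
  and space_gauss [simp]: "space gauss = UNIV"
  by (simp_all add: gauss_def)

lemma prob_space_gauss: "prob_space gauss"
  unfolding gauss_def by (rule prob_space_normal_density) simp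

interpretation gauss_product: product_prob_space "\<lambda>_. gauss" I for I :: "'i set"
  using prob_space_gauss by (rule product_prob_spaceI)

lemma prob_space_noise_space: "prob_space (noise_space T)"
  unfolding noise_space_def by (rule gauss_product.P.prob_space_axioms)

lemma integrable_gauss_power: "integrable gauss (\<lambda>x. x ^ k)"
  unfolding gauss_def
  by (subst integrable_density) (auto simp: integrable_std_normal_moment)

lemma gauss_mean: "(LINT x|gauss. x) = 0"
  unfolding gauss_def using integral_std_normal_moment_odd[of 0]
  by (subst integral_density) auto

lemma gauss_second_moment: "(LINT x|gauss. x\<^sup>2) = 1"
  unfolding gauss_def using integral_std_normal_moment_even[of 1]
  by (subst integral_density) auto

lemma distr_gauss_uminus: "distr gauss borel uminus = gauss"
proof (rule measure_eqI)
  fix A :: "real set" assume "A \<in> sets (distr gauss borel uminus)"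
  then have [measurable]: "A \<in> sets borel" by simp
  have [measurable]: "uminus -` A \<in> sets borel"
    by (rule measurable_sets_borel) measurable
  let ?f = "\<lambda>x. ennreal (std_normal_density x) * indicator (uminus -` A) x"
  have "emeasure (distr gauss borel uminus) A = (\<integral>\<^sup>+x. ?f x \<partial>lborel)"
    by (simp add: emeasure_distr gauss_def emeasure_density)
  also have "\<dots> = (\<integral>\<^sup>+x. ?f (-x) \<partial>lborel)"
    using nn_integral_real_affine[of ?f "-1" 0] by simp
  also have "\<dots> = (\<integral>\<^sup>+x. ennreal (std_normal_density x) * indicator A x \<partial>lborel)"
    by (intro nn_integral_cong) (auto simp: normal_density_def indicator_def)
  also have "\<dots> = emeasure gauss A"
    by (simp add: gauss_def emeasure_density)
  finally show "emeasure (distr gauss borel uminus) A = emeasure gauss A" .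
qed simp

lemma noise_component [measurable]:
  "i \<in> {1..T} \<times> UNIV \<Longrightarrow> (\<lambda>g. g i) \<in> borel_measurable (noise_space T)"
  unfolding noise_space_def
  using measurable_component_singleton[of i "{1..T} \<times> UNIV" "\<lambda>_. gauss"]
  by (simp cong: measurable_cong_sets)

lemma distr_noise_component:
  assumes "i \<in> {1..T} \<times> UNIV"
  shows "distr (noise_space T) borel (\<lambda>g. g i) = gauss"
proof -
  have "distr (noise_space T) borel (\<lambda>g. g i) = distr (noise_space T) gauss (\<lambda>g. g i)"
    by (rule distr_cong) auto
  also have "\<dots> = gauss"
    unfolding noise_space_def by (rule distr_PiM_component) (use assms prob_space_gauss in auto)
  finally show ?thesis .
qed

lemma integrable_noise_component:
  fixes f :: "real \<Rightarrow> real"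
  assumes "i \<in> {1..T} \<times> UNIV" and "integrable gauss f"
  shows "integrable (noise_space T) (\<lambda>g. f (g i))"
proof (rule integrable_distr[of "\<lambda>g. g i" _ borel])
  show "(\<lambda>g. g i) \<in> measurable (noise_space T) borel" using assms(1) by measurable
  show "integrable (distr (noise_space T) borel (\<lambda>g. g i)) f"
    using assms by (simp only: distr_noise_component)
qed

lemma integral_noise_component:
  fixes f :: "real \<Rightarrow> real"
  assumes "i \<in> {1..T} \<times> UNIV" and "f \<in> borel_measurable borel"
  shows "(LINT g|noise_space T. f (g i)) = (LINT x|gauss. f x)"
proof -
  have "(LINT x|gauss. f x) = (LINT x|distr (noise_space T) borel (\<lambda>g. g i). f x)"
    using assms by (simp only: distr_noise_component)
  also have "\<dots> = (LINT g|noise_space T. f (g i))"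
    using assms by (intro integral_distr) auto
  finally show ?thesis ..
qed

text \<open>Fubini with coordinate \<open>i\<close> integrated innermost: \<open>F\<close> is
  constant along it, so the inner integral is a multiple of the Gaussian mean.\<close>

lemma noise_orthogonal:
  fixes F :: "(nat \<times> 2 \<Rightarrow> real) \<Rightarrow> real"
  assumes i: "i \<in> {1..T} \<times> UNIV"
    and int: "integrable (noise_space T) (\<lambda>g. F g * g i)"
    and F: "\<And>g y. F (g(i := y)) = F g"
  shows "(LINT g|noise_space T. F g * g i) = 0"
proof -
  let ?I = "{1..T} \<times> UNIV :: (nat \<times> 2) set"
  have *: "insert i (?I - {i}) = ?I" using i by auto
  have "(LINT g|noise_space T. F g * g i) = (LINT g|PiM (insert i (?I - {i})) (\<lambda>_. gauss). F g * g i)"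
    by (simp only: * noise_space_def)
  also have "\<dots> = (LINT g|PiM (?I - {i}) (\<lambda>_. gauss). LINT y|gauss. F (g(i := y)) * (g(i := y)) i)"
    by (rule gauss_product.product_integral_insert)
      (use int in \<open>auto simp only: * noise_space_def finite_Diff finite_cartesian_product finite finite_atLeastAtMost\<close>)
  also have "\<dots> = 0"
    by (simp add: F gauss_mean)
  finally show ?thesis .
qed

text \<open>Each factor is symmetric, and a finite product of image measures is the image of the
  product. The restriction keeps the flipped point extensional, as a product space requires.\<close>

lemma distr_noise_space_uminus:
  "distr (noise_space T) (noise_space T) (\<lambda>g. \<lambda>i\<in>{1..T} \<times> UNIV. - g i) = noise_space T"
proof -
  let ?I = "{1..T} \<times> UNIV :: (nat \<times> 2) set"
  have "distr (PiM ?I (\<lambda>_. gauss)) (PiM ?I (\<lambda>_. gauss)) (compose ?I uminus) =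
      PiM ?I (\<lambda>_. distr gauss gauss uminus)"
    using prob_space_gauss
    by (intro distr_PiM_finite_prob_space product_prob_spaceI) (auto cong: measurable_cong_sets)
  moreover have "distr gauss gauss uminus = gauss"
    using distr_gauss_uminus by (metis distr_cong sets_gauss)
  ultimately show ?thesis
    by (simp add: noise_space_def compose_def [abs_def])
qed

section \<open>Random walks driven by the noise\<close>

text \<open>Here \<open>m\<close> is the drift and \<open>s t l v\<close> the noise deviation of
  action \<open>l\<close> at step \<open>t\<close> from position \<open>v\<close>. An arbitrary
  \<open>s\<close> covers the walks of finite \<open>M\<close>, the limiting, the truncated and the
  noiseless walk alike.\<close>

primrec walk :: "real \<Rightarrow> (nat \<Rightarrow> 2 \<Rightarrow> real \<Rightarrow> real) \<Rightarrow> (nat \<times> 2 \<Rightarrow> real) \<Rightarrow> nat \<Rightarrow> real" where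
  "walk m s g 0 = 0"
| "walk m s g (Suc t) = walk m s g t + m
     + s t 1 (walk m s g t) * g (Suc t, 1) - s t 2 (walk m s g t) * g (Suc t, 2)"

lemma walk_measurable [measurable]:
  assumes s [measurable]: "\<And>t l. s t l \<in> borel_measurable borel" and "t \<le> T"
  shows "(\<lambda>g. walk m s g t) \<in> borel_measurable (noise_space T)"
  using assms(2)
proof (induction t)
  case (Suc t)
  then have [measurable]: "(\<lambda>g. walk m s g t) \<in> borel_measurable (noise_space T)" by simp
  have [measurable]: "(\<lambda>g. g (Suc t, l)) \<in> borel_measurable (noise_space T)" for l
    using Suc.prems by (intro noise_component) auto
  show ?case by simp
qed simp

text \<open>Adaptedness: position \<open>t\<close> uses only the noise of packets up to
  \<open>t\<close>. This makes \<open>noise_orthogonal\<close> applicable to every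
  increment.\<close>

lemma walk_fun_upd: "t < fst i \<Longrightarrow> walk m s (g(i := y)) t = walk m s g t"
  by (induction t) auto

lemma walk_zero: "walk m (\<lambda>_ _ _. 0) g t = real t * m"
  by (induction t) (auto simp: algebra_simps)

text \<open>The position moves with \<open>n\<close> together with the coefficients, so
  \<open>s n\<close> has to converge along every convergent sequence of arguments, not merely
  pointwise.\<close>

lemma walk_tendsto:
  assumes "\<And>j l v x. j < t \<Longrightarrow> x \<longlonglongrightarrow> v \<Longrightarrow> (\<lambda>n. s n j l (x n)) \<longlonglongrightarrow> s' j l v"
  shows "(\<lambda>n. walk m (s n) g t) \<longlonglongrightarrow> walk m s' g t"
  using assms
proof (induction t)
  case (Suc t)
  have "(\<lambda>n. walk m (s n) g t) \<longlonglongrightarrow> walk m s' g t"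
    by (rule Suc.IH) (use Suc.prems in auto)
  then show ?case
    unfolding walk.simps by (intro tendsto_intros Suc.prems) auto
qed simp

text \<open>The walks converge pathwise and the constant \<open>B\<close> dominates on a probability
  space. Boundedness of \<open>f\<close> replaces moment bounds on the walks, whose deviations may
  be unbounded.\<close>

lemma noise_expectation_tendsto:
  assumes s: "\<And>n t l. s n t l \<in> borel_measurable borel" "\<And>t l. s' t l \<in> borel_measurable borel"
    and conv: "\<And>j l v x. j < t \<Longrightarrow> x \<longlonglongrightarrow> v \<Longrightarrow> (\<lambda>n. s n j l (x n)) \<longlonglongrightarrow> s' j l v"
    and f: "continuous_on UNIV f" "\<And>v. \<bar>f v\<bar> \<le> (B::real)" and "t \<le> T"
  shows "(\<lambda>n. LINT g|noise_space T. f (walk m (s n) g t)) \<longlonglongrightarrow> (LINT g|noise_space T. f (walk m s' g t))"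
proof -
  interpret prob_space "noise_space T" by (rule prob_space_noise_space)
  have [measurable]: "f \<in> borel_measurable borel" using f(1) by (rule borel_measurable_continuous_onI)
  show ?thesis
  proof (rule integral_dominated_convergence[where w = "\<lambda>_. B"])
    show "AE g in noise_space T. (\<lambda>n. f (walk m (s n) g t)) \<longlonglongrightarrow> f (walk m s' g t)"
      by (intro AE_I2 continuous_on_tendsto_compose[OF f(1)] walk_tendsto conv) auto
  qed (use s \<open>t \<le> T\<close> f(2) in auto)
qed

section \<open>Fourth moments of the noise\<close>

lemma square_le_one_plus_power4: "b * b \<le> 1 + b ^ 4" for b :: real
proof -
  have "0 \<le> (b * b - 1)\<^sup>2" "0 \<le> b * b" by simp_all
  moreover have "(b * b - 1)\<^sup>2 = 1 + b ^ 4 - 2 * (b * b)"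
    by (simp add: power2_eq_square power4_eq_xxxx algebra_simps)
  ultimately show ?thesis by linarith
qed

text \<open>The l1 norm of the noise controls a walk with bounded deviations at all times at once;
  its fourth power is the error term of the small-noise expansion.\<close>

definition noise_bound :: "nat \<Rightarrow> (nat \<times> 2 \<Rightarrow> real) \<Rightarrow> real" where
  "noise_bound T g = (\<Sum>i\<in>{1..T} \<times> UNIV. \<bar>g i\<bar>)"

lemma noise_bound_nonneg: "0 \<le> noise_bound T g"
  by (simp add: noise_bound_def sum_nonneg)

lemma noise_bound_component: "i \<in> {1..T} \<times> UNIV \<Longrightarrow> \<bar>g i\<bar> \<le> noise_bound T g"
  unfolding noise_bound_def by (rule member_le_sum) auto

lemma noise_bound_measurable [measurable]: "noise_bound T \<in> borel_measurable (noise_space T)"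
  unfolding noise_bound_def by (intro borel_measurable_sum borel_measurable_abs noise_component)

text \<open>Cauchy--Schwarz applied twice to sums over the \<open>2 * T\<close> coordinates.\<close>

lemma noise_bound_power4:
  "noise_bound T g ^ 4 \<le> real (2 * T) ^ 3 * (\<Sum>i\<in>{1..T} \<times> UNIV. g i ^ 4)"
proof -
  let ?I = "{1..T} \<times> UNIV :: (nat \<times> 2) set"
  have card: "card ?I = 2 * T" by (simp add: card_cartesian_product)
  have "noise_bound T g ^ 4 = ((noise_bound T g)\<^sup>2)\<^sup>2" by simp
  also have "\<dots> \<le> ((\<Sum>i\<in>?I. (g i)\<^sup>2) * real (2 * T))\<^sup>2"
    using sum_squared_le_sum_of_squares[of "\<lambda>i. \<bar>g i\<bar>" ?I]
    by (intro power_mono) (auto simp: noise_bound_def card)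
  also have "\<dots> = (\<Sum>i\<in>?I. (g i)\<^sup>2)\<^sup>2 * real (2 * T) ^ 2" by (rule power_mult_distrib)
  also have "\<dots> \<le> ((\<Sum>i\<in>?I. ((g i)\<^sup>2)\<^sup>2) * real (2 * T)) * real (2 * T) ^ 2"
    using sum_squared_le_sum_of_squares[of "\<lambda>i. (g i)\<^sup>2" ?I]
    by (intro mult_right_mono) (auto simp: card)
  also have "\<dots> = real (2 * T) ^ 3 * (\<Sum>i\<in>?I. g i ^ 4)"
    by (simp add: power2_eq_square power3_eq_cube power4_eq_xxxx mult.assoc)
  finally show ?thesis .
qed

lemma noise_bound_integrable_power4: "integrable (noise_space T) (\<lambda>g. noise_bound T g ^ 4)"
proof (rule Bochner_Integration.integrable_bound)
  show "integrable (noise_space T) (\<lambda>g. real (2 * T) ^ 3 * (\<Sum>i\<in>{1..T} \<times> UNIV. g i ^ 4))"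
    by (intro integrable_mult_right Bochner_Integration.integrable_sum
        integrable_noise_component integrable_gauss_power)
  show "AE g in noise_space T. norm (noise_bound T g ^ 4)
      \<le> norm (real (2 * T) ^ 3 * (\<Sum>i\<in>{1..T} \<times> UNIV. g i ^ 4))"
    using noise_bound_power4 by (auto intro!: AE_I2 order.trans[OF noise_bound_power4])
qed measurable

lemma integrable_if_noise_bound:
  fixes F :: "(nat \<times> 2 \<Rightarrow> real) \<Rightarrow> real"
  assumes "F \<in> borel_measurable (noise_space T)"
    and "\<And>g. g \<in> space (noise_space T) \<Longrightarrow> \<bar>F g\<bar> \<le> C * (1 + noise_bound T g ^ 4)"
  shows "integrable (noise_space T) F"
proof -
  interpret prob_space "noise_space T" by (rule prob_space_noise_space)
  show ?thesis
  proof (rule Bochner_Integration.integrable_bound)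
    show "integrable (noise_space T) (\<lambda>g. C * (1 + noise_bound T g ^ 4))"
      using noise_bound_integrable_power4 by simp
    show "AE g in noise_space T. norm (F g) \<le> norm (C * (1 + noise_bound T g ^ 4))"
    proof (rule AE_I2)
      fix g assume "g \<in> space (noise_space T)"
      from assms(2)[OF this] show "norm (F g) \<le> norm (C * (1 + noise_bound T g ^ 4))"
        unfolding real_norm_def by (rule order.trans) (rule abs_ge_self)
    qed
  qed fact
qed

text \<open>Bounded deviations make the centred walk a square-integrable martingale. The bound
  concerns steps before \<open>T\<close> only, because for the truncated walk it comes from a radius
  that grows with \<open>T\<close>.\<close>

locale bounded_walk =
  fixes m :: real and s :: "nat \<Rightarrow> 2 \<Rightarrow> real \<Rightarrow> real" and B :: real and T :: nat
  assumes s_measurable [measurable]: "\<And>t l. s t l \<in> borel_measurable borel"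
    and s_bound: "\<And>t l v. t < T \<Longrightarrow> \<bar>s t l v\<bar> \<le> B"
begin

abbreviation centred :: "(nat \<times> 2 \<Rightarrow> real) \<Rightarrow> nat \<Rightarrow> real" where
  "centred g t \<equiv> walk m s g t - real t * m"

lemma B_nonneg: "0 < T \<Longrightarrow> 0 \<le> B"
  using s_bound[of 0 1 0] by linarith

lemma centred_measurable [measurable]:
  "t \<le> T \<Longrightarrow> (\<lambda>g. centred g t) \<in> borel_measurable (noise_space T)"
  by measurable

lemma increment_measurable [measurable]:
  "t < T \<Longrightarrow> (\<lambda>g. s t l (walk m s g t)) \<in> borel_measurable (noise_space T)"
  by measurable

lemma centred_bound:
  assumes "t \<le> T"
  shows "\<bar>centred g t\<bar> \<le> B * noise_bound T g"
proof -
  have "\<bar>centred g t\<bar> \<le> B * (\<Sum>i\<in>{1..t} \<times> UNIV. \<bar>g i\<bar>)"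
    using assms
  proof (induction t)
    case (Suc t)
    have s: "\<bar>s t l (walk m s g t) * g (Suc t, l)\<bar> \<le> B * \<bar>g (Suc t, l)\<bar>" for l
      using s_bound[of t] Suc.prems by (simp add: abs_mult mult_right_mono)
    have "(\<Sum>i\<in>{1..Suc t} \<times> (UNIV::2 set). \<bar>g i\<bar>)
        = (\<Sum>i\<in>{1..t} \<times> UNIV. \<bar>g i\<bar>) + \<bar>g (Suc t, 1)\<bar> + \<bar>g (Suc t, 2)\<bar>"
      by (simp add: sum.cartesian_product' sum_2)
    moreover have "\<bar>centred g (Suc t)\<bar> \<le> \<bar>centred g t\<bar> + \<bar>s t 1 (walk m s g t) * g (Suc t, 1)\<bar>
        + \<bar>s t 2 (walk m s g t) * g (Suc t, 2)\<bar>"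
      by (simp add: algebra_simps)
    ultimately show ?case
      using Suc s[of 1] s[of 2] by (simp add: algebra_simps)
  qed simp
  also have "\<dots> \<le> B * noise_bound T g"
  \<comment> \<open>For \<open>T = 0\<close> nothing forces \<open>B\<close> to be nonnegative, but
    then \<open>noise_bound\<close> is an empty sum.\<close>
  proof (cases "t = 0")
    case True
    then show ?thesis
      using B_nonneg noise_bound_nonneg[of T g] by (cases "T = 0") (auto simp: noise_bound_def)
  next
    case False
    then show ?thesis unfolding noise_bound_def
      using assms B_nonneg by (intro mult_left_mono sum_mono2) auto
  qed
  finally show ?thesis .
qed

lemma increment_integrable:
  assumes "t < T"
  shows "integrable (noise_space T) (\<lambda>g. s t l (walk m s g t) * g (Suc t, l))"
proof (rule Bochner_Integration.integrable_bound)
  show "integrable (noise_space T) (\<lambda>g. B * g (Suc t, l))"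
    using assms integrable_gauss_power[of 1]
    by (intro integrable_mult_right integrable_noise_component[where f = "\<lambda>x. x"]) auto
  show "(\<lambda>g. s t l (walk m s g t) * g (Suc t, l)) \<in> borel_measurable (noise_space T)"
    using assms by (intro borel_measurable_times increment_measurable noise_component) auto
  show "AE g in noise_space T. norm (s t l (walk m s g t) * g (Suc t, l)) \<le> norm (B * g (Suc t, l))"
    using s_bound[OF assms] by (intro AE_I2) (auto simp: abs_mult intro!: mult_right_mono intro: order.trans[OF _ abs_ge_self])
qed

text \<open>The martingale property: the deviation is determined by packets up to \<open>t\<close>,
  the noise factor belongs to packet \<open>t + 1\<close>.\<close>

lemma increment_mean:
  assumes "t < T"
  shows "(LINT g|noise_space T. s t l (walk m s g t) * g (Suc t, l)) = 0"
  using assms by (intro noise_orthogonal increment_integrable) (auto simp: walk_fun_upd)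

lemma centred_mean:
  assumes "t \<le> T"
  shows "integrable (noise_space T) (\<lambda>g. centred g t) \<and> (LINT g|noise_space T. centred g t) = 0"
  using assms
proof (induction t)
  case (Suc t)
  have eq: "centred g (Suc t) = centred g t + s t 1 (walk m s g t) * g (Suc t, 1)
      - s t 2 (walk m s g t) * g (Suc t, 2)" for g
    by (simp add: algebra_simps)
  show ?case
    unfolding eq using Suc increment_integrable[of t] increment_mean[of t] by simp
qed simp

text \<open>Only the very first increment of action 1 correlates with \<open>g (1, 1)\<close>. Every
  other increment carries a different noise variable, independent of all the remaining factors, so
  the covariance stays constant in \<open>t\<close>.\<close>

lemma centred_first_noise:
  assumes "0 < t" "t \<le> T"
  shows "integrable (noise_space T) (\<lambda>g. centred g t * g (1, 1)) \<and>
    (LINT g|noise_space T. centred g t * g (1, 1)) = s 0 1 0"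
  using assms
proof (induction t)
  case (Suc t)
  let ?d = "\<lambda>l g. s t l (walk m s g t) * g (Suc t, l) * g (1, 1)"
  let ?F = "\<lambda>l g. s t l (walk m s g t) * g (1, 1)"
  have T: "t < T" "0 < T" using Suc.prems by auto
  have int: "integrable (noise_space T) (?d l)" for l
  proof (rule integrable_if_noise_bound)
    show "?d l \<in> borel_measurable (noise_space T)"
      using T by (intro borel_measurable_times increment_measurable noise_component) auto
    fix g
    define b where "b = noise_bound T g"
    have b: "0 \<le> b" "\<bar>g (Suc t, l)\<bar> \<le> b" "\<bar>g (1, 1)\<bar> \<le> b"
      unfolding b_def using T by (auto intro!: noise_bound_component noise_bound_nonneg)
    have "\<bar>?d l g\<bar> \<le> B * b * b"
      unfolding abs_mult using b s_bound[OF T(1)] B_nonneg[OF T(2)]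
      by (intro mult_mono) auto
    also have "\<dots> \<le> B * (1 + b ^ 4)"
      using mult_left_mono[OF square_le_one_plus_power4 B_nonneg[OF T(2)]] by (simp add: mult.assoc)
    finally show "\<bar>?d l g\<bar> \<le> B * (1 + noise_bound T g ^ 4)" by (simp add: b_def)
  qed
  \<comment> \<open>The factor \<open>g (1, 1)\<close> is absorbed into \<open>?F\<close>: its index
    differs from \<open>(Suc t, l)\<close>, so \<open>?F\<close> is still constant along that
    coordinate.\<close>
  have orth: "(LINT g|noise_space T. ?d l g) = 0" if "(Suc t, l) \<noteq> (1, 1)" for l
  proof -
    have "(LINT g|noise_space T. ?F l g * g (Suc t, l)) = 0"
      using that T int[of l]
      by (intro noise_orthogonal) (auto simp: walk_fun_upd mult_ac)
    then show ?thesis by (simp add: mult_ac)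
  qed
  have eq: "centred g (Suc t) * g (1, 1) = centred g t * g (1, 1) + ?d 1 g - ?d 2 g" for g
    by (simp add: algebra_simps)
  show ?case
  proof (cases "t = 0")
    case True
    \<comment> \<open>The walk starts at 0, so the first deviation is the constant
      \<open>s 0 1 0\<close> and the unit variance of the noise remains.\<close>
    have "(LINT g|noise_space T. (g (1, 1))\<^sup>2) = 1"
      using integral_noise_component[of "(1, 1)" T "\<lambda>x. x\<^sup>2"] T gauss_second_moment by simp
    then have "(LINT g|noise_space T. ?d 1 g) = s 0 1 0"
      using True by (simp add: power2_eq_square mult.assoc)
    then show ?thesis
      unfolding eq using True int orth[of 2] by simp
  next
    case False
    then show ?thesis
      unfolding eq using Suc int orth by simp
  qed
qed simp

lemma centred_square_integrable:
  assumes "t \<le> T"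
  shows "integrable (noise_space T) (\<lambda>g. (centred g t)\<^sup>2)"
proof (rule integrable_if_noise_bound)
  show "(\<lambda>g. (centred g t)\<^sup>2) \<in> borel_measurable (noise_space T)" using assms by measurable
  fix g
  define b where "b = noise_bound T g"
  have "(centred g t)\<^sup>2 \<le> (B * b)\<^sup>2"
    using centred_bound[OF assms, of g] by (simp add: abs_le_square_iff[symmetric] b_def)
  also have "\<dots> = B\<^sup>2 * (b * b)" by (simp add: power2_eq_square)
  also have "\<dots> \<le> B\<^sup>2 * (1 + b ^ 4)"
    by (intro mult_left_mono square_le_one_plus_power4) auto
  finally show "\<bar>(centred g t)\<^sup>2\<bar> \<le> B\<^sup>2 * (1 + noise_bound T g ^ 4)" by (simp add: b_def)
qed

text \<open>Cauchy--Schwarz against the first noise variable, whose correlation with the walk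
  survives all later steps.\<close>

lemma centred_variance_ge:
  assumes "0 < t" "t \<le> T"
  shows "(s 0 1 0)\<^sup>2 \<le> (LINT g|noise_space T. (centred g t)\<^sup>2)"
proof -
  let ?c = "s 0 1 0"
  have T: "0 < T" using assms by simp
  have g2: "(LINT g|noise_space T. (g (1, 1))\<^sup>2) = 1" "integrable (noise_space T) (\<lambda>g. (g (1, 1))\<^sup>2)"
    using integral_noise_component[of "(1, 1)" T "\<lambda>x. x\<^sup>2"] T gauss_second_moment
      integrable_noise_component[of "(1, 1)" T "\<lambda>x. x\<^sup>2"] integrable_gauss_power[of 2] by auto
  \<comment> \<open>The left side integrates to \<open>2 * ?c\<^sup>2 - ?c\<^sup>2\<close>; the
    inequality is the expanded square of \<open>centred g t - ?c * g (1, 1)\<close>.\<close>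
  have "(LINT g|noise_space T. 2 * ?c * (centred g t * g (1, 1)) - ?c\<^sup>2 * (g (1, 1))\<^sup>2)
      \<le> (LINT g|noise_space T. (centred g t)\<^sup>2)"
  proof (rule integral_mono)
    fix g :: "nat \<times> 2 \<Rightarrow> real"
    have "0 \<le> (centred g t - ?c * g (1, 1))\<^sup>2" by simp
    then show "2 * ?c * (centred g t * g (1, 1)) - ?c\<^sup>2 * (g (1, 1))\<^sup>2 \<le> (centred g t)\<^sup>2"
      by (simp add: power2_eq_square algebra_simps)
  qed (use assms g2 centred_first_noise centred_square_integrable in auto)
  then show ?thesis
    using centred_first_noise[OF assms] g2 by (simp add: power2_eq_square)
qed

end

section \<open>The limiting walk under small noise\<close>

text \<open>The Gibbs probability as a logistic function of the estimate difference in units of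
  \<open>sqrt (D * M)\<close>. In these units the temperature is
  \<open>\<beta> * sqrt (t + 1/2)\<close>, free of \<open>D\<close> and \<open>M\<close>.\<close>

definition choice_prob :: "real \<Rightarrow> nat \<Rightarrow> 2 \<Rightarrow> real \<Rightarrow> real" where
  "choice_prob \<beta> t l v =
     (if t = 0 then 1/2 else 1 / (1 + exp ((if l = 1 then v else - v) / (\<beta> * sqrt (real t + 1/2)))))"

text \<open>The conditional standard deviation of the weighted loss \<open>X / \<pi>\<close> in
  units of \<open>sqrt (D * M)\<close>, where \<open>M\<close> cancels. The argument
  \<open>q\<close> varies with the action because the two failure probabilities differ for finite
  \<open>M\<close>.\<close>

definition packet_sd :: "real \<Rightarrow> real \<Rightarrow> (2 \<Rightarrow> real) \<Rightarrow> nat \<Rightarrow> 2 \<Rightarrow> real \<Rightarrow> real" where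
  "packet_sd \<beta> D q t l v =
     sqrt (q l * (1 - choice_prob \<beta> t l v * q l) / (choice_prob \<beta> t l v * D))"

text \<open>In the limit both actions have failure probability \<open>q\<close> in the noise; their
  vanishing gap survives in the drift, amplified by the packet size. The parameters \<open>q\<close>
  and \<open>D\<close> enter through \<open>packet_sd\<close> alone.\<close>

definition limit_loss :: "real \<Rightarrow> real \<Rightarrow> real \<Rightarrow> real \<Rightarrow> nat \<Rightarrow> real" where
  "limit_loss \<beta> d q D T = 2 * d / real T * (\<Sum>t<T. LINT g|noise_space T.
     choice_prob \<beta> t 2 (walk (- 2 * d / sqrt (real T)) (packet_sd \<beta> D (\<lambda>_. q)) g t))"

definition noiseless_loss :: "real \<Rightarrow> real \<Rightarrow> nat \<Rightarrow> real" where
  "noiseless_loss \<beta> d T =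
     2 * d / real T * (\<Sum>t<T. choice_prob \<beta> t 2 (real t * (- 2 * d / sqrt (real T))))"

section \<open>Logistic choice probabilities\<close>

lemma choice_prob_pos: "0 < choice_prob \<beta> t l v"
  by (simp add: choice_prob_def add_pos_pos)

lemma choice_prob_less_1: "choice_prob \<beta> t l v < 1"
  by (simp add: choice_prob_def add_pos_pos divide_simps)

lemma abs_choice_prob_le_1: "\<bar>choice_prob \<beta> t l v\<bar> \<le> 1"
  using choice_prob_pos[of \<beta> t l v] choice_prob_less_1[of \<beta> t l v] by simp

lemma choice_prob_2: "choice_prob \<beta> t 2 v = 1 - choice_prob \<beta> t 1 v"
proof -
  have "1 / (1 + exp (- x)) = 1 - 1 / (1 + exp x)" for x :: real
  proof -
    have "1 + exp x \<noteq> 0" using exp_gt_zero[of x] by linarith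
    moreover have "1 + exp (- x) = (1 + exp x) / exp x" by (simp add: exp_minus field_simps)
    ultimately show ?thesis by (simp add: diff_divide_eq_iff)
  qed
  then show ?thesis by (simp add: choice_prob_def)
qed

lemma choice_prob_continuous: "continuous_on UNIV (choice_prob \<beta> t l)"
proof -
  have "1 + exp x \<noteq> 0" for x :: real using exp_gt_zero[of x] by linarith
  then have "continuous_on UNIV (\<lambda>v. 1 / (1 + exp (c * v)))" for c :: real
    by (intro continuous_intros) simp
  from this[of "1 / (\<beta> * sqrt (real t + 1/2))"] this[of "- 1 / (\<beta> * sqrt (real t + 1/2))"]
  show ?thesis
    unfolding choice_prob_def by (cases "t = 0"; cases "l = 1") simp_all
qed

lemma choice_prob_measurable [measurable]: "choice_prob \<beta> t l \<in> borel_measurable borel"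
  by (rule borel_measurable_continuous_onI[OF choice_prob_continuous])

lemma packet_sd_measurable [measurable]: "packet_sd \<beta> D q t l \<in> borel_measurable borel"
  unfolding packet_sd_def by measurable

lemma choice_prob_tendsto:
  "x \<longlonglongrightarrow> v \<Longrightarrow> (\<lambda>n. choice_prob \<beta> t l (x n)) \<longlonglongrightarrow> choice_prob \<beta> t l v"
  using choice_prob_continuous by (rule continuous_on_tendsto_compose) auto

text \<open>From \<open>t = 1\<close> on the temperature is at least \<open>\<beta>\<close>, which
  gives a bound uniform in time. It keeps \<open>packet_sd\<close>, which has the probability in its
  denominator, bounded on bounded sets.\<close>

lemma choice_prob_ge:
  assumes "0 < \<beta>" "\<bar>v\<bar> \<le> R"
  shows "1 / (1 + exp (R / \<beta>)) \<le> choice_prob \<beta> t l v"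
proof (cases "t = 0")
  case True
  have "1 \<le> exp (R / \<beta>)" using assms by simp
  then have "1 / (1 + exp (R / \<beta>)) \<le> 1 / 2" by (intro frac_le) auto
  then show ?thesis using True by (simp add: choice_prob_def)
next
  case False
  define w where "w = (if l = 1 then v else - v)"
  have "1 \<le> sqrt (real t + 1/2)" using False by simp
  then have "\<beta> \<le> \<beta> * sqrt (real t + 1/2)" using assms(1) by simp
  moreover have "w \<le> R" "0 \<le> R" using assms(2) by (auto simp: w_def)
  ultimately have "w / (\<beta> * sqrt (real t + 1/2)) \<le> R / \<beta>"
    using assms(1) by (intro frac_le) auto
  then have "exp (w / (\<beta> * sqrt (real t + 1/2))) \<le> exp (R / \<beta>)" by simp
  then show ?thesis
    unfolding choice_prob_def w_def[symmetric] using False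
    by (simp add: add_pos_pos frac_le)
qed

lemma choice_prob_2_strict_mono:
  assumes "0 < \<beta>" "0 < t" "x < y"
  shows "choice_prob \<beta> t 2 x < choice_prob \<beta> t 2 y"
proof -
  have "x / (\<beta> * sqrt (real t + 1/2)) < y / (\<beta> * sqrt (real t + 1/2))"
    using assms by (intro divide_strict_right_mono) auto
  then show ?thesis using assms by (simp add: choice_prob_def add_pos_pos frac_less2)
qed

lemma choice_prob_2_minus: "choice_prob \<beta> t 2 (- v) = 1 - choice_prob \<beta> t 2 v"
  using choice_prob_2[of \<beta> t v] by (simp add: choice_prob_def)

lemma choice_prob_expectation_integrable:
  assumes "\<And>t l. s t l \<in> borel_measurable borel" "t \<le> T"
  shows "integrable (noise_space T) (\<lambda>g. choice_prob \<beta> j l (walk m s g t))"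
proof -
  interpret prob_space "noise_space T" by (rule prob_space_noise_space)
  show ?thesis
    using assms by (intro integrable_const_bound[where B = 1]) (auto simp: abs_choice_prob_le_1)
qed

text \<open>Near \<open>x0\<close> the function minus \<open>c * (x - x0)\<^sup>2\<close> is still
  convex, so it lies above its tangent at \<open>x0\<close>.\<close>

lemma quadratic_lower_bound:
  fixes f f' f'' :: "real \<Rightarrow> real"
  assumes f: "\<And>x. DERIV f x :> f' x" and f': "\<And>x. DERIV f' x :> f'' x"
    and cont: "isCont f'' x0" and pos: "0 < f'' x0"
  obtains c \<delta> where "0 < c" "0 < \<delta>" "\<delta> \<le> 1"
    "\<And>x. \<bar>x\<bar> \<le> \<delta> \<Longrightarrow> f x0 + f' x0 * x + c * x\<^sup>2 \<le> f (x0 + x)"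
proof -
  \<comment> \<open>With a quarter, continuity up to an error \<open>c\<close> leaves
    \<open>f''\<close> above \<open>3 * c\<close>, more than the \<open>2 * c\<close> taken away by
    the quadratic.\<close>
  define c where "c = f'' x0 / 4"
  have c: "0 < c" using pos by (simp add: c_def)
  from cont c obtain r where r: "0 < r" "\<And>x. dist x x0 < r \<Longrightarrow> dist (f'' x) (f'' x0) < c"
    unfolding continuous_at_eps_delta by blast
  \<comment> \<open>The cap at 1 later keeps the walk inside the distance 1 at which its noise is
    switched off.\<close>
  define \<delta> where "\<delta> = min 1 (r / 2)"
  let ?A = "{x0 - \<delta>..x0 + \<delta>}"
  have \<delta>: "0 < \<delta>" "\<delta> \<le> 1" "\<delta> < r" using r(1) by (auto simp: \<delta>_def)
  have f'': "2 * c \<le> f'' x" if "x \<in> ?A" for x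
  proof -
    have "dist x x0 < r" using that \<delta>(3) by (auto simp: dist_real_def)
    from r(2)[OF this] have "\<bar>f'' x - f'' x0\<bar> < c" by (simp add: dist_real_def)
    moreover have "f'' x0 = 4 * c" by (simp add: c_def)
    ultimately show ?thesis using c by linarith
  qed
  have sq: "((\<lambda>x. c * (x - x0)\<^sup>2) has_field_derivative 2 * c * (x - x0)) (at x within S)" for x S
    by (rule derivative_eq_intros refl)+ simp
  have lin: "DERIV (\<lambda>x. 2 * c * (x - x0)) x :> 2 * c" for x
    by (rule derivative_eq_intros refl)+ simp
  have convex: "convex_on ?A (\<lambda>x. f x - c * (x - x0)\<^sup>2)"
  proof (rule f''_ge0_imp_convex)
    show "DERIV (\<lambda>x. f x - c * (x - x0)\<^sup>2) x :> f' x - 2 * c * (x - x0)" for x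
      by (rule DERIV_diff[OF f sq])
    show "DERIV (\<lambda>x. f' x - 2 * c * (x - x0)) x :> f'' x - 2 * c" for x
      by (rule DERIV_diff[OF f' lin])
  next
    fix x assume "x \<in> ?A" then show "0 \<le> f'' x - 2 * c" using f'' by simp
  qed (rule convex_real_interval)
  have deriv: "((\<lambda>x. f x - c * (x - x0)\<^sup>2) has_field_derivative f' x0) (at x0 within ?A)"
    using DERIV_diff[OF has_field_derivative_at_within[OF f[of x0]] sq[of x0 ?A]] by simp
  have tangent: "f' x0 * (x - x0) \<le> (f x - c * (x - x0)\<^sup>2) - (f x0 - c * (x0 - x0)\<^sup>2)"
    if "x \<in> ?A" for x
    by (rule convex_on_imp_above_tangent[OF convex connected_Icc _ that deriv]) (use \<delta> in simp)
  show ?thesis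
  proof (rule that[OF c \<delta>(1,2)])
    fix x :: real assume "\<bar>x\<bar> \<le> \<delta>"
    then have "x0 + x \<in> ?A" by (auto simp: abs_le_iff)
    from tangent[OF this] show "f x0 + f' x0 * x + c * x\<^sup>2 \<le> f (x0 + x)" by simp
  qed
qed

text \<open>The second derivative of the logistic function has the sign of
  \<open>exp (- x / \<tau>) - 1\<close>, positive on the negative axis.\<close>

lemma choice_prob_2_quadratic_lower_bound:
  assumes "0 < \<beta>" "0 < t" "v < 0"
  obtains a c \<delta> where "0 < c" "0 < \<delta>" "\<delta> \<le> 1"
    "\<And>x. \<bar>x\<bar> \<le> \<delta> \<Longrightarrow>
      choice_prob \<beta> t 2 v + a * x + c * x\<^sup>2 \<le> choice_prob \<beta> t 2 (v + x)"
proof -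
  define \<tau> where "\<tau> = \<beta> * sqrt (real t + 1/2)"
  have \<tau>: "0 < \<tau>" using assms by (simp add: \<tau>_def)
  have cp: "choice_prob \<beta> t 2 = (\<lambda>x. 1 / (1 + exp (- x / \<tau>)))"
    using assms by (auto simp: choice_prob_def \<tau>_def)
  have nz: "1 + exp x \<noteq> 0" for x :: real using exp_gt_zero[of x] by linarith
  let ?f' = "\<lambda>x. exp (- x / \<tau>) / \<tau> / (1 + exp (- x / \<tau>))\<^sup>2"
  let ?f'' = "\<lambda>x. exp (- x / \<tau>) * (exp (- x / \<tau>) - 1) / \<tau>\<^sup>2 / (1 + exp (- x / \<tau>)) ^ 3"
  show ?thesis
  proof (rule quadratic_lower_bound[of "choice_prob \<beta> t 2" ?f' ?f'' v])
    have exp: "DERIV (\<lambda>x. exp (- x / \<tau>)) x :> - exp (- x / \<tau>) / \<tau>" for x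
      using DERIV_fun_exp[OF DERIV_cdivide[OF DERIV_minus[OF DERIV_ident]], of \<tau> x] by simp
    have exp_plus_1: "DERIV (\<lambda>x. 1 + exp (- x / \<tau>)) x :> - exp (- x / \<tau>) / \<tau>" for x
      using DERIV_add[OF DERIV_const exp] by simp
    show "DERIV (choice_prob \<beta> t 2) x :> ?f' x" for x
      unfolding cp using DERIV_divide[OF DERIV_const[of 1] exp_plus_1 nz, of x]
      by (simp add: power2_eq_square)
    show "DERIV ?f' x :> ?f'' x" for x
    proof -
      define e where "e = exp (- x / \<tau>)"
      have e: "0 < e" by (simp add: e_def)
      have "DERIV ?f' x :> ((- e / \<tau>) / \<tau> * (1 + e)\<^sup>2 - e / \<tau> * (2 * (- e / \<tau> * (1 + e)))) / ((1 + e)\<^sup>2 * (1 + e)\<^sup>2)"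
        using DERIV_divide[OF DERIV_cdivide[OF exp[of x], of \<tau>] DERIV_power[OF exp_plus_1[of x], of 2]] nz[of "- x / \<tau>"]
        by (simp add: e_def)
      also have "((- e / \<tau>) / \<tau> * (1 + e)\<^sup>2 - e / \<tau> * (2 * (- e / \<tau> * (1 + e)))) / ((1 + e)\<^sup>2 * (1 + e)\<^sup>2)
          = e * (e - 1) / \<tau>\<^sup>2 / (1 + e) ^ 3"
      proof -
        have "(- e / \<tau>) / \<tau> * (1 + e)\<^sup>2 - e / \<tau> * (2 * (- e / \<tau> * (1 + e))) = (1 + e) * (e * (e - 1) / \<tau>\<^sup>2)"
          using \<tau> by (simp add: field_simps power2_eq_square)
        moreover have "(1 + e)\<^sup>2 * (1 + e)\<^sup>2 = (1 + e) * (1 + e) ^ 3"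
          by (simp add: power2_eq_square power3_eq_cube)
        ultimately show ?thesis using e by simp
      qed
      finally show ?thesis by (simp add: e_def)
    qed
    show "isCont ?f'' v"
      using nz \<tau> by (intro continuous_intros) simp_all
    have "1 < exp (- v / \<tau>)" using assms(3) \<tau> by (simp add: divide_neg_pos)
    then show "0 < ?f'' v" using \<tau> by (simp add: add_pos_pos)
  qed (use that in blast)
qed

text \<open>For \<open>\<rho>\<close> beyond \<open>\<delta>\<close> the quartic term outweighs the
  whole quadratic, so the left side is nonpositive and \<open>f\<close> is nonnegative. There
  \<open>x\<close> may differ from \<open>y\<close>: later \<open>y\<close> belongs to the truncated
  walk, \<open>x\<close> to the true one, and \<open>\<rho>\<close> is the noise size.\<close>

lemma quadratic_lower_bound_global:
  fixes f :: "real \<Rightarrow> real"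
  assumes f: "\<And>x. 0 \<le> f x" "f v \<le> 1"
    and c: "0 < c" and \<delta>: "0 < \<delta>"
    and local: "\<And>x. \<bar>x\<bar> \<le> \<delta> \<Longrightarrow> f v + a * x + c * x\<^sup>2 \<le> f (v + x)"
    and y: "\<bar>y\<bar> \<le> \<rho>" and x: "\<rho> \<le> \<delta> \<Longrightarrow> x = y"
  shows "f v + a * y + c * y\<^sup>2 - (1 + \<bar>a\<bar> + c) * (1 + 1 / \<delta> ^ 4) * \<rho> ^ 4 \<le> f (v + x)"
proof (cases "\<rho> \<le> \<delta>")
  case True
  have "0 \<le> (1 + \<bar>a\<bar> + c) * (1 + 1 / \<delta> ^ 4) * \<rho> ^ 4" using c \<delta> by simp
  then show ?thesis using local[of y] x[OF True] y True by auto
next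
  case False
  have \<rho>: "0 \<le> \<rho>" using y by linarith
  have "\<delta> ^ 4 \<le> \<rho> ^ 4" using False \<delta> by (intro power_mono) auto
  then have one: "1 \<le> 1 / \<delta> ^ 4 * \<rho> ^ 4" using \<delta> by (simp add: field_simps)
  have sq: "\<rho> * \<rho> \<le> 1 + \<rho> ^ 4" by (rule square_le_one_plus_power4)
  have lin: "\<rho> \<le> 1 + \<rho> ^ 4"
  proof (cases "\<rho> \<le> 1")
    case True
    moreover have "0 \<le> \<rho> ^ 4" by simp
    ultimately show ?thesis by linarith
  next
    case False then show ?thesis using self_le_power[of \<rho> 4] by linarith
  qed
  have "a * y \<le> \<bar>a\<bar> * \<bar>y\<bar>" by (metis abs_ge_self abs_mult)
  also have "\<dots> \<le> \<bar>a\<bar> * (1 + \<rho> ^ 4)" using y lin by (intro mult_left_mono) auto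
  finally have "a * y \<le> \<bar>a\<bar> * (1 + \<rho> ^ 4)" .
  moreover have "y\<^sup>2 \<le> \<rho> * \<rho>" using abs_le_square_iff[of y \<rho>] y \<rho> by (simp add: power2_eq_square)
  then have "c * y\<^sup>2 \<le> c * (1 + \<rho> ^ 4)" using sq c by (intro mult_left_mono) auto
  moreover have "f v \<le> 1 * (1 + \<rho> ^ 4)" using f(2) \<rho> by (simp add: add_increasing2)
  ultimately have "f v + a * y + c * y\<^sup>2 \<le> 1 * (1 + \<rho> ^ 4) + \<bar>a\<bar> * (1 + \<rho> ^ 4) + c * (1 + \<rho> ^ 4)"
    by (intro add_mono)
  also have "\<dots> = (1 + \<bar>a\<bar> + c) * (1 + \<rho> ^ 4)" by (simp only: distrib_right)
  finally have "f v + a * y + c * y\<^sup>2 \<le> (1 + \<bar>a\<bar> + c) * (1 + \<rho> ^ 4)" .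
  also have "\<dots> \<le> (1 + \<bar>a\<bar> + c) * (1 / \<delta> ^ 4 * \<rho> ^ 4 + \<rho> ^ 4)"
    using one c by (intro mult_left_mono) auto
  also have "\<dots> = (1 + \<bar>a\<bar> + c) * (1 + 1 / \<delta> ^ 4) * \<rho> ^ 4" by (simp add: algebra_simps)
  finally show ?thesis using f(1)[of "v + x"] by linarith
qed

text \<open>The logistic function is strictly convex at the negative value \<open>t * m\<close> of the noiseless walk,
  so a small noise raises the expectation at second order. The step deviations are unbounded
  in \<open>v\<close>, hence the expectation of the walk need not exist; the walk is therefore compared
  with one whose noise is switched off at distance \<open>1\<close> from the noiseless path.\<close>

lemma small_noise_expectation:
  assumes \<beta>: "0 < \<beta>" and m: "m < 0" and t: "0 < t" "t \<le> T"
  obtains \<kappa>\<^sub>0 where "0 < \<kappa>\<^sub>0"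
    "\<And>q D. 0 < q \<Longrightarrow> q < 1 \<Longrightarrow> 0 < D \<Longrightarrow> q / D < \<kappa>\<^sub>0 \<Longrightarrow>
      choice_prob \<beta> t 2 (real t * m)
        < (LINT g|noise_space T. choice_prob \<beta> t 2 (walk m (packet_sd \<beta> D (\<lambda>_. q)) g t))"
proof -
  interpret prob_space "noise_space T" by (rule prob_space_noise_space)
  define v where "v = real t * m"
  have "v < 0" using m t by (simp add: v_def mult_pos_neg)
  then obtain a c \<delta> where c: "0 < c" and \<delta>: "0 < \<delta>" "\<delta> \<le> 1" and local:
    "\<And>x. \<bar>x\<bar> \<le> \<delta> \<Longrightarrow> choice_prob \<beta> t 2 v + a * x + c * x\<^sup>2 \<le> choice_prob \<beta> t 2 (v + x)"
    by (rule choice_prob_2_quadratic_lower_bound[OF \<beta> t(1)]) auto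
  define A where "A = (1 + \<bar>a\<bar> + c) * (1 + 1 / \<delta> ^ 4)"
  \<comment> \<open>\<open>K\<close> bounds the reciprocal choice probabilities within distance 1 of
    the noiseless path up to time \<open>T\<close>.\<close>
  define K where "K = 1 + exp ((1 + real T * \<bar>m\<bar>) / \<beta>)"
  define R4 where "R4 = (LINT g|noise_space T. noise_bound T g ^ 4)"
  \<comment> \<open>With \<open>\<kappa> = q / D\<close>, the quadratic gain is at least
    \<open>c * \<kappa>\<close> and the quartic error is
    \<open>A * K\<^sup>2 * R4 * \<kappa>\<^sup>2\<close>; below this threshold the gain wins. The
    added 1 keeps the denominator positive.\<close>
  define \<kappa>\<^sub>0 where "\<kappa>\<^sub>0 = c / (A * K\<^sup>2 * R4 + 1)"
  have "0 < 1 + \<bar>a\<bar> + c" "0 < 1 + 1 / \<delta> ^ 4" using c \<delta> by (simp_all add: add_nonneg_pos add_pos_pos)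
  then have A: "0 < A" unfolding A_def by (rule mult_pos_pos)
  have K: "0 < K" by (simp add: K_def add_pos_pos)
  have R4: "0 \<le> R4" unfolding R4_def by (intro integral_nonneg_AE) (simp add: noise_bound_nonneg)
  have den: "0 < A * K\<^sup>2 * R4 + 1" using A K R4 by (intro add_nonneg_pos mult_nonneg_nonneg) auto
  show ?thesis
  proof (rule that[of \<kappa>\<^sub>0])
    show "0 < \<kappa>\<^sub>0" using c den by (simp add: \<kappa>\<^sub>0_def)
    fix q D :: real
    assume q: "0 < q" "q < 1" and D: "0 < D" and small: "q / D < \<kappa>\<^sub>0"
    define \<kappa> where "\<kappa> = q / D"
    have \<kappa>: "0 < \<kappa>" using q D by (simp add: \<kappa>_def)
    define s where "s = packet_sd \<beta> D (\<lambda>_. q)"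
    define s' where "s' = (\<lambda>j l w. if \<bar>w - real j * m\<bar> \<le> 1 then s j l w else 0)"
    \<comment> \<open>The normalized variance is at most \<open>\<kappa>\<close> over the choice
      probability, hence at most \<open>K * \<kappa>\<close> wherever the noise is on.\<close>
    define B where "B = sqrt (K * \<kappa>)"
    have [measurable]: "s j l \<in> borel_measurable borel" for j l by (simp add: s_def)
    interpret W: bounded_walk m s' B T
    proof
      show "s' j l \<in> borel_measurable borel" for j l unfolding s'_def by measurable
      fix j l and w :: real assume j: "j < T"
      show "\<bar>s' j l w\<bar> \<le> B"
      proof (cases "\<bar>w - real j * m\<bar> \<le> 1")
        case True
        define \<pi> where "\<pi> = choice_prob \<beta> j l w"
        have "\<bar>real j * m\<bar> \<le> real T * \<bar>m\<bar>" using j by (simp add: abs_mult mult_right_mono)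
        then have "\<bar>w\<bar> \<le> 1 + real T * \<bar>m\<bar>" using True by linarith
        from choice_prob_ge[OF \<beta> this] have "1 / K \<le> \<pi>" by (simp add: K_def \<pi>_def)
        have \<pi>: "0 < \<pi>" "\<pi> < 1" by (simp_all add: \<pi>_def choice_prob_pos choice_prob_less_1)
        with \<open>1 / K \<le> \<pi>\<close> K have "1 / \<pi> \<le> K" by (simp add: divide_le_eq mult.commute)
        have "0 \<le> \<pi> * q" "\<pi> * q \<le> 1" using \<pi> q by (auto intro: mult_le_one)
        have "q * (1 - \<pi> * q) / (\<pi> * D) = \<kappa> * (1 - \<pi> * q) * (1 / \<pi>)" by (simp add: \<kappa>_def)
        also have "\<dots> \<le> \<kappa> * 1 * K" using \<kappa> \<open>0 \<le> \<pi> * q\<close> \<open>\<pi> * q \<le> 1\<close> \<open>1 / \<pi> \<le> K\<close> \<pi>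
          by (intro mult_mono) auto
        finally have "s j l w \<le> B" unfolding s_def packet_sd_def B_def \<pi>_def[symmetric]
          by (simp add: mult.commute)
        moreover have "0 \<le> s j l w" unfolding s_def packet_sd_def \<pi>_def[symmetric]
          using q D \<pi> \<open>\<pi> * q \<le> 1\<close> by simp
        ultimately show ?thesis using True by (simp add: s'_def)
      next
        case False then show ?thesis using K \<kappa> by (simp add: s'_def B_def)
      qed
    qed
    \<comment> \<open>The truncated walk then stays within \<open>\<delta> \<le> 1\<close> of the
      noiseless path, so its noise is never switched off. The induction uses the bound for the
      truncated walk, the only one available.\<close>
    have agree: "walk m s g t = walk m s' g t" if "B * noise_bound T g \<le> \<delta>" for g
    proof -
      have "j \<le> T \<Longrightarrow> walk m s g j = walk m s' g j" for j
      proof (induction j)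
        case (Suc j)
        have "\<bar>W.centred g j\<bar> \<le> 1" using W.centred_bound[of j g] Suc.prems that \<delta> by simp
        then show ?case using Suc by (simp add: s'_def)
      qed simp
      then show ?thesis using t by simp
    qed
    have pointwise: "choice_prob \<beta> t 2 v + a * W.centred g t + c * (W.centred g t)\<^sup>2
        - A * (B ^ 4 * noise_bound T g ^ 4) \<le> choice_prob \<beta> t 2 (walk m s g t)" for g
    proof -
      have "choice_prob \<beta> t 2 v + a * W.centred g t + c * (W.centred g t)\<^sup>2
        - A * (B * noise_bound T g) ^ 4 \<le> choice_prob \<beta> t 2 (v + (walk m s g t - v))"
        unfolding A_def
      proof (rule quadratic_lower_bound_global[OF _ _ c \<delta>(1) local])
        show "\<bar>W.centred g t\<bar> \<le> B * noise_bound T g" by (rule W.centred_bound[OF t(2)])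
        show "walk m s g t - v = W.centred g t" if "B * noise_bound T g \<le> \<delta>"
          using agree[OF that] by (simp only: v_def)
      qed (simp_all only: choice_prob_pos choice_prob_less_1 less_imp_le)
      then show ?thesis by (simp add: power_mult_distrib)
    qed
    \<comment> \<open>The first packet is played with probability \<open>1/2\<close>, so its
      normalized variance is \<open>\<kappa> * (2 - q)\<close>, at least \<open>\<kappa>\<close>.
      This is a lower bound for the variance at all later times.\<close>
    have "s' 0 1 0 = s 0 1 0" by (simp add: s'_def)
    also have "(s 0 1 0)\<^sup>2 = q * (1 - 1 / 2 * q) / (1 / 2 * D)"
      using q D by (simp add: s_def packet_sd_def choice_prob_def)
    also have "\<dots> = \<kappa> * (2 - q)" using D by (simp add: \<kappa>_def divide_simps)
    also have "\<dots> \<ge> \<kappa>" using \<kappa> q by simp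
    finally have var: "\<kappa> \<le> (LINT g|noise_space T. (W.centred g t)\<^sup>2)"
      using W.centred_variance_ge[OF t] by simp
    have B4: "B ^ 4 = K\<^sup>2 * \<kappa>\<^sup>2"
    proof -
      have "B ^ 4 = (B\<^sup>2)\<^sup>2" by simp
      also have "B\<^sup>2 = K * \<kappa>" using K \<kappa> by (simp add: B_def)
      finally show ?thesis by (simp add: power_mult_distrib)
    qed
    have "\<kappa> * (A * K\<^sup>2 * R4 + 1) < c" using small den by (simp add: \<kappa>\<^sub>0_def \<kappa>_def pos_less_divide_eq)
    then have "\<kappa> * (A * K\<^sup>2 * R4) < c" using \<kappa> by (simp add: algebra_simps)
    then have "\<kappa> * (\<kappa> * (A * K\<^sup>2 * R4)) < \<kappa> * c" using \<kappa> by simp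
    then have gain: "A * (B ^ 4 * R4) < c * \<kappa>" by (simp add: B4 power2_eq_square mult_ac)
    \<comment> \<open>On integration the linear term of the expansion vanishes, since the centred
      walk has mean 0.\<close>
    have "choice_prob \<beta> t 2 v < choice_prob \<beta> t 2 v + (c * \<kappa> - A * (B ^ 4 * R4))"
      using gain by simp
    also have "\<dots> \<le> choice_prob \<beta> t 2 v + (c * (LINT g|noise_space T. (W.centred g t)\<^sup>2) - A * (B ^ 4 * R4))"
      using var c by simp
    also have "\<dots> = (LINT g|noise_space T. choice_prob \<beta> t 2 v + a * W.centred g t + c * (W.centred g t)\<^sup>2
        - A * (B ^ 4 * noise_bound T g ^ 4))"
      using W.centred_mean[OF t(2)] W.centred_square_integrable[OF t(2)] noise_bound_integrable_power4[of T]
      by (simp add: R4_def prob_space)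
    also have "\<dots> \<le> (LINT g|noise_space T. choice_prob \<beta> t 2 (walk m s g t))"
      using pointwise W.centred_mean[OF t(2)] W.centred_square_integrable[OF t(2)]
        noise_bound_integrable_power4[of T]
      by (intro integral_mono choice_prob_expectation_integrable t) auto
    finally show "choice_prob \<beta> t 2 (real t * m)
        < (LINT g|noise_space T. choice_prob \<beta> t 2 (walk m (packet_sd \<beta> D (\<lambda>_. q)) g t))"
      by (simp only: v_def s_def)
  qed
qed

section \<open>The limiting loss\<close>

text \<open>The gain occurs in every packet after the first, so a second packet must exist; the
  minimum of the finitely many thresholds serves all of them.\<close>

lemma limit_loss_less_noise:
  assumes \<beta>: "0 < \<beta>" and d: "0 < d" and T: "2 \<le> T"
  obtains \<kappa> where "0 < \<kappa>"
    "\<And>q D. 0 < q \<Longrightarrow> q < 1 \<Longrightarrow> 0 < D \<Longrightarrow> q / D < \<kappa> \<Longrightarrow>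
      noiseless_loss \<beta> d T < limit_loss \<beta> d q D T"
proof -
  define m where "m = - 2 * d / sqrt (real T)"
  have m: "m < 0" using d T by (simp add: m_def divide_neg_pos)
  let ?E = "\<lambda>q D t. LINT g|noise_space T. choice_prob \<beta> t 2 (walk m (packet_sd \<beta> D (\<lambda>_. q)) g t)"
  have "\<exists>\<kappa>>0. \<forall>q D. 0 < q \<longrightarrow> q < 1 \<longrightarrow> 0 < D \<longrightarrow> q / D < \<kappa> \<longrightarrow> choice_prob \<beta> t 2 (real t * m) < ?E q D t"
    if "t \<in> {1..<T}" for t
  proof -
    have "0 < t" "t \<le> T" using that by auto
    from small_noise_expectation[OF \<beta> m this] show ?thesis by metis
  qed
  then obtain \<kappa> where \<kappa>: "\<And>t. t \<in> {1..<T} \<Longrightarrow> 0 < \<kappa> t"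
    "\<And>t q D. t \<in> {1..<T} \<Longrightarrow> 0 < q \<Longrightarrow> q < 1 \<Longrightarrow> 0 < D \<Longrightarrow> q / D < \<kappa> t
      \<Longrightarrow> choice_prob \<beta> t 2 (real t * m) < ?E q D t"
    by metis
  show ?thesis
  proof (rule that[of "Min (\<kappa> ` {1..<T})"])
    show "0 < Min (\<kappa> ` {1..<T})" using \<kappa>(1) T by (subst Min_gr_iff) auto
    fix q D :: real
    assume *: "0 < q" "q < 1" "0 < D" "q / D < Min (\<kappa> ` {1..<T})"
    have less: "choice_prob \<beta> t 2 (real t * m) < ?E q D t" if "t \<in> {1..<T}" for t
    proof -
      have "Min (\<kappa> ` {1..<T}) \<le> \<kappa> t" using that by (intro Min_le) auto
      with * show ?thesis by (intro \<kappa>(2)[OF that]) auto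
    qed
    interpret prob_space "noise_space T" by (rule prob_space_noise_space)
    have "(\<Sum>t<T. choice_prob \<beta> t 2 (real t * m)) < (\<Sum>t<T. ?E q D t)"
    \<comment> \<open>The terms at 0 are both \<open>1/2\<close>; strictness is taken from the term
      at 1.\<close>
    proof (rule sum_strict_mono_strong[of _ 1])
      show "choice_prob \<beta> t 2 (real t * m) \<le> ?E q D t" if "t \<in> {..<T}" for t
        using less[of t] that by (cases "t = 0") (auto simp: choice_prob_def prob_space)
    qed (use less[of 1] T in auto)
    then show "noiseless_loss \<beta> d T < limit_loss \<beta> d q D T"
      unfolding noiseless_loss_def limit_loss_def m_def[symmetric]
      using d T by (intro mult_strict_left_mono) auto
  qed
qed

text \<open>The squared deviation has the factor \<open>q / D\<close>, while the rest converges.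
  Stated for sequences, this covers both \<open>q\<close> tending to 0 with \<open>D\<close> fixed
  and \<open>D\<close> growing with \<open>q\<close> fixed.\<close>

lemma limit_loss_tendsto_noiseless_loss:
  assumes D: "\<And>n. D n \<noteq> 0" and q: "q \<longlonglongrightarrow> q'" and qD: "(\<lambda>n. q n / D n) \<longlonglongrightarrow> 0"
  shows "(\<lambda>n. limit_loss \<beta> d (q n) (D n) T) \<longlonglongrightarrow> noiseless_loss \<beta> d T"
proof -
  interpret prob_space "noise_space T" by (rule prob_space_noise_space)
  let ?m = "- 2 * d / sqrt (real T)"
  have conv: "(\<lambda>n. packet_sd \<beta> (D n) (\<lambda>_. q n) j l (x n)) \<longlonglongrightarrow> 0" if "x \<longlonglongrightarrow> v" for j l v x
  proof -
    have "(\<lambda>n. sqrt (q n / D n * (1 - choice_prob \<beta> j l (x n) * q n) / choice_prob \<beta> j l (x n)))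
        \<longlonglongrightarrow> sqrt (0 * (1 - choice_prob \<beta> j l v * q') / choice_prob \<beta> j l v)"
      using choice_prob_pos[of \<beta> j l v]
      by (intro tendsto_real_sqrt tendsto_divide tendsto_mult tendsto_diff tendsto_const qD q
          choice_prob_tendsto that) simp
    then show ?thesis by (simp add: packet_sd_def mult.commute)
  qed
  have "(\<lambda>n. LINT g|noise_space T. choice_prob \<beta> t 2 (walk ?m (packet_sd \<beta> (D n) (\<lambda>_. q n)) g t))
      \<longlonglongrightarrow> (LINT g|noise_space T. choice_prob \<beta> t 2 (walk ?m (\<lambda>_ _ _. 0) g t))"
    if "t < T" for t
    using that conv
    by (intro noise_expectation_tendsto[where B = 1] choice_prob_continuous abs_choice_prob_le_1) auto
  then have "(\<lambda>n. limit_loss \<beta> d (q n) (D n) T) \<longlonglongrightarrow> 2 * d / real T *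
      (\<Sum>t<T. LINT g|noise_space T. choice_prob \<beta> t 2 (walk ?m (\<lambda>_ _ _. 0) g t))"
    unfolding limit_loss_def by (intro tendsto_intros) auto
  then show ?thesis by (simp only: walk_zero noiseless_loss_def lebesgue_integral_const prob_space scaleR_one)
qed

text \<open>A loss constant in \<open>q\<close> would equal its limit at vanishing \<open>q\<close>,
  the noiseless loss, contradicting the strict inequality for small \<open>q / D\<close>.\<close>

lemma limit_loss_depends_on_q:
  assumes "0 < \<beta>" "0 < d" "0 < D" "2 \<le> T"
  shows "\<exists>q\<in>{0<..<1}. \<exists>q'\<in>{0<..<1}. limit_loss \<beta> d q D T \<noteq> limit_loss \<beta> d q' D T"
proof (rule ccontr)
  assume "\<not> ?thesis"
  then have "\<forall>q\<in>{0<..<1}. \<forall>q'\<in>{0<..<1}. limit_loss \<beta> d q D T = limit_loss \<beta> d q' D T"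
    by blast
  note eq = this[THEN bspec, THEN bspec]
  have const: "limit_loss \<beta> d q D T = limit_loss \<beta> d (1/2) D T" if "0 < q" "q < 1" for q
    by (rule eq) (use that in simp_all)
  \<comment> \<open>The shift by 2 keeps every term strictly below 1.\<close>
  define q where "q = (\<lambda>n. 1 / real (n + 2))"
  have q: "0 < q n" "q n < 1" for n by (simp_all add: q_def)
  have q0: "q \<longlonglongrightarrow> 0"
    using LIMSEQ_ignore_initial_segment[OF lim_1_over_n, of 2] by (simp only: q_def)
  then have qD: "(\<lambda>n. q n / D) \<longlonglongrightarrow> 0" using tendsto_divide[OF q0 tendsto_const[of D]] assms by simp
  have "(\<lambda>n. limit_loss \<beta> d (q n) D T) \<longlonglongrightarrow> noiseless_loss \<beta> d T"
    using assms by (intro limit_loss_tendsto_noiseless_loss[OF _ q0 qD]) simp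
  then have "noiseless_loss \<beta> d T = limit_loss \<beta> d (1/2) D T"
    unfolding const[OF q] by (simp only: LIMSEQ_const_iff)
  moreover obtain \<kappa> where \<kappa>: "0 < \<kappa>"
    "\<And>q D. 0 < q \<Longrightarrow> q < 1 \<Longrightarrow> 0 < D \<Longrightarrow> q / D < \<kappa> \<Longrightarrow> noiseless_loss \<beta> d T < limit_loss \<beta> d q D T"
    by (rule limit_loss_less_noise[OF assms(1,2,4)]) simp
  moreover obtain n where "q n / D < \<kappa>"
    using order_tendstoD(2)[OF qD \<kappa>(1)] by (auto simp: eventually_sequentially)
  ultimately show False using const[OF q(1,2)[of n]] \<kappa>(2)[OF q(1,2)[of n] assms(3)] by simp
qed

text \<open>The same contradiction, reached by letting \<open>D\<close> grow to infinity.\<close>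

lemma limit_loss_depends_on_D:
  assumes "0 < \<beta>" "0 < d" "0 < q" "q < 1" "2 \<le> T"
  shows "\<exists>D>0. \<exists>D'>0. limit_loss \<beta> d q D T \<noteq> limit_loss \<beta> d q D' T"
proof (rule ccontr)
  assume "\<not> ?thesis"
  then have const: "limit_loss \<beta> d q D T = limit_loss \<beta> d q 1 T" if "0 < D" for D
    using that zero_less_one by blast
  define D where "D n = real (Suc n)" for n
  have D: "0 < D n" for n by (simp add: D_def)
  have qD: "(\<lambda>n. q / D n) \<longlonglongrightarrow> 0"
    using tendsto_mult[OF tendsto_const[of q] LIMSEQ_inverse_real_of_nat]
    by (simp add: D_def divide_inverse)
  have "(\<lambda>n. limit_loss \<beta> d q (D n) T) \<longlonglongrightarrow> noiseless_loss \<beta> d T"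
    using D by (intro limit_loss_tendsto_noiseless_loss[OF _ tendsto_const qD]) (simp add: less_imp_neq[symmetric])
  then have "noiseless_loss \<beta> d T = limit_loss \<beta> d q 1 T"
    unfolding const[OF D] by (simp only: LIMSEQ_const_iff)
  moreover obtain \<kappa> where \<kappa>: "0 < \<kappa>"
    "\<And>q D. 0 < q \<Longrightarrow> q < 1 \<Longrightarrow> 0 < D \<Longrightarrow> q / D < \<kappa> \<Longrightarrow> noiseless_loss \<beta> d T < limit_loss \<beta> d q D T"
    by (rule limit_loss_less_noise[OF assms(1,2,5)]) simp
  moreover obtain n where "q / D n < \<kappa>"
    using order_tendstoD(2)[OF qD \<kappa>(1)] by (auto simp: eventually_sequentially)
  ultimately show False using const[OF D[of n]] \<kappa>(2)[OF assms(3,4) D[of n]] by simp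
qed

text \<open>Flipping the signs of all noise variables maps \<open>m + y\<close> to \<open>m - y\<close>; by the symmetry of the
  logistic function the probabilities at \<open>m - y\<close> and \<open>y - m\<close> add up to \<open>1\<close>, and \<open>m + y < y - m\<close>.\<close>

lemma first_step_expectation_less_half:
  assumes \<beta>: "0 < \<beta>" and m: "m < 0" and T: "1 \<le> T"
    and s: "\<And>t l. s t l \<in> borel_measurable borel"
  shows "(LINT g|noise_space T. choice_prob \<beta> 1 2 (walk m s g 1)) < 1/2"
proof -
  interpret prob_space "noise_space T" by (rule prob_space_noise_space)
  let ?I = "{1..T} \<times> UNIV :: (nat \<times> 2) set"
  let ?flip = "\<lambda>g :: nat \<times> 2 \<Rightarrow> real. \<lambda>i\<in>?I. - g i"
  let ?f = "\<lambda>g. choice_prob \<beta> 1 2 (walk m s g 1)"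
  have flip [measurable]: "?flip \<in> measurable (noise_space T) (noise_space T)"
    unfolding noise_space_def by (rule measurable_restrict) measurable
  have int: "integrable (noise_space T) ?f"
    by (rule choice_prob_expectation_integrable[OF s T])
  have f: "?f \<in> borel_measurable (noise_space T)" using int by (rule borel_measurable_integrable)
  have flip_eq: "(LINT g|noise_space T. ?f (?flip g)) = (LINT g|noise_space T. ?f g)"
    using integral_distr[OF flip f] by (simp only: distr_noise_space_uminus)
  have int_flip: "integrable (noise_space T) (\<lambda>g. ?f (?flip g))"
    using integrable_distr_eq[OF flip f] int by (simp only: distr_noise_space_uminus)
  have "?f g + ?f (?flip g) < 1" for g
  proof -
    define y where "y = s 0 1 0 * g (1, 1) - s 0 2 0 * g (1, 2)"
    have "walk m s g 1 = y + m" "walk m s (?flip g) 1 = - (y - m)" using T by (simp_all add: y_def)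
    then show ?thesis
      using choice_prob_2_strict_mono[OF \<beta>, of 1 "y + m" "y - m"] m
      by (simp only: choice_prob_2_minus) simp
  qed
  then have "(LINT g|noise_space T. ?f g + ?f (?flip g)) < (LINT g|noise_space T. 1)"
    using int int_flip by (intro integral_less_AE_space) (auto simp: emeasure_space_1)
  then show ?thesis using int int_flip flip_eq by (simp add: prob_space)
qed

lemma limit_loss_depends_on_T:
  assumes "0 < \<beta>" "0 < d"
  shows "limit_loss \<beta> d q D 2 < limit_loss \<beta> d q D 1"
proof -
  interpret prob_space "noise_space T" for T by (rule prob_space_noise_space)
  have zero: "choice_prob \<beta> 0 2 v = 1/2" for v by (simp add: choice_prob_def)
  have "limit_loss \<beta> d q D 1 = d" by (simp add: limit_loss_def zero prob_space)
  moreover have "limit_loss \<beta> d q D 2 = d * (1/2 + (LINT g|noise_space 2.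
      choice_prob \<beta> 1 2 (walk (- 2 * d / sqrt (real 2)) (packet_sd \<beta> D (\<lambda>_. q)) g 1)))"
    by (simp add: limit_loss_def zero prob_space lessThan_Suc numeral_2_eq_2 del: walk.simps)
  moreover have "\<dots> < d * 1"
    using first_step_expectation_less_half[OF assms(1), of "- 2 * d / sqrt (real 2)" 2 "packet_sd \<beta> D (\<lambda>_. q)"] assms
    by (intro mult_strict_left_mono) (simp_all add: divide_neg_pos del: walk.simps)
  ultimately show ?thesis by simp
qed

section \<open>Convergence of the normalized regret\<close>

text \<open>Gibbs weights depend only on the difference of the two estimates, and
  \<open>sqrt (D * M)\<close> cancels against the temperature.\<close>

lemma strategy_eq_choice_prob:
  assumes \<beta>: "0 < \<beta>" and D: "0 < D" and M: "0 < M"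
    and z: "z $ 1 - z $ 2 = sqrt (D * real M) * v"
  shows "strategy \<beta> D M t z $ l = choice_prob \<beta> t l v"
proof (cases "t = 0")
  case True
  then show ?thesis by (simp add: strategy_def choice_prob_def)
next
  case False
  define b where "b = temperature \<beta> D M t"
  have b: "b = sqrt (D * real M) * (\<beta> * sqrt (real t + 1/2))"
    by (simp add: b_def temperature_def real_sqrt_mult)
  have "0 < sqrt (D * real M)" using D M by simp
  then have quot: "(z $ 1 - z $ 2) / b = v / (\<beta> * sqrt (real t + 1/2))"
    unfolding z b by (rule mult_divide_mult_cancel_left[OF less_imp_neq[symmetric]])
  have frac: "exp x / (exp x + exp y) = 1 / (1 + exp (y - x))" for x y :: real
    by (simp add: exp_diff divide_simps add_pos_pos)
  have "strategy \<beta> D M t z $ 1 = 1 / (1 + exp ((z $ 1 - z $ 2) / b))"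
    using False frac[of "- (z $ 1) / b" "- (z $ 2) / b"]
    by (simp add: strategy_def gibbs_def b_def[symmetric] diff_divide_distrib)
  moreover have "strategy \<beta> D M t z $ 2 = 1 / (1 + exp (- ((z $ 1 - z $ 2) / b)))"
    using False frac[of "- (z $ 2) / b" "- (z $ 1) / b"]
    by (simp add: strategy_def gibbs_def b_def[symmetric] diff_divide_distrib add.commute)
  ultimately show ?thesis
    using False exhaust_2[of l] unfolding quot by (auto simp: choice_prob_def)
qed

lemma packet_sd_scale:
  assumes "0 < \<pi>" "0 < D"
  shows "sqrt (loss_var \<pi> q M) / \<pi> = sqrt (D * real M) * sqrt (q * (1 - \<pi> * q) / (\<pi> * D))"
proof -
  have "sqrt (loss_var \<pi> q M) / \<pi> = sqrt (loss_var \<pi> q M / \<pi>\<^sup>2)"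
    using assms by (simp add: real_sqrt_divide)
  also have "loss_var \<pi> q M / \<pi>\<^sup>2 = D * real M * (q * (1 - \<pi> * q) / (\<pi> * D))"
    using assms by (simp add: loss_var_def power2_eq_square)
  finally show ?thesis by (simp only: real_sqrt_mult)
qed

text \<open>The loss in packet \<open>t + 1\<close> as a function on the noise space, with the walk
  in place of the accumulated estimates.\<close>

definition packet_loss :: "real \<Rightarrow> real \<Rightarrow> (2 \<Rightarrow> real) \<Rightarrow> nat \<Rightarrow> real \<Rightarrow> nat \<Rightarrow> 2 \<Rightarrow> (nat \<times> 2 \<Rightarrow> real) \<Rightarrow> real" where
  "packet_loss \<beta> D q M m t l g =
     (let \<pi> = choice_prob \<beta> t l (walk m (packet_sd \<beta> D q) g t)
      in loss_mean \<pi> (q l) M + sqrt (loss_var \<pi> (q l) M) * g (Suc t, l))"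

text \<open>Division by the action probability makes the estimates unbiased, so the drift per packet
  is the constant \<open>M * (q 1 - q 2)\<close> whatever the current position. The claim is
  deterministic, for one realization \<open>x\<close> and \<open>g\<close>.\<close>

lemma zeta_diff_eq_walk:
  assumes \<beta>: "0 < \<beta>" and D: "0 < D" and M: "0 < M"
    and m: "real M * (q 1 - q 2) = sqrt (D * real M) * m"
    and x: "\<And>t l. t < T \<Longrightarrow> x (Suc t) $ l = loss_mean (action_prob \<beta> D M x t $ l) (q l) M
      + sqrt (loss_var (action_prob \<beta> D M x t $ l) (q l) M) * g (Suc t, l)"
    and "t \<le> T"
  shows "zeta \<beta> D M x t $ 1 - zeta \<beta> D M x t $ 2 = sqrt (D * real M) * walk m (packet_sd \<beta> D q) g t"
  using \<open>t \<le> T\<close>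
proof (induction t)
  case (Suc t)
  let ?w = "walk m (packet_sd \<beta> D q) g t"
  define \<pi> where "\<pi> l = choice_prob \<beta> t l ?w" for l
  have strategy: "strategy \<beta> D M t (zeta \<beta> D M x t) $ l = \<pi> l" for l
    unfolding \<pi>_def using Suc by (intro strategy_eq_choice_prob \<beta> D M) auto
  have step: "x (Suc t) $ l / \<pi> l
      = real M * q l + sqrt (D * real M) * packet_sd \<beta> D q t l ?w * g (Suc t, l)" for l
  proof -
    have \<pi>: "0 < \<pi> l" by (simp add: \<pi>_def choice_prob_pos)
    have "x (Suc t) $ l / \<pi> l = real M * q l + sqrt (loss_var (\<pi> l) (q l) M) / \<pi> l * g (Suc t, l)"
      using x[of t l] Suc.prems \<pi> by (simp add: action_prob_def strategy loss_mean_def add_divide_distrib)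
    then show ?thesis
      unfolding packet_sd_scale[OF \<pi> D] by (simp only: packet_sd_def \<pi>_def)
  qed
  have "zeta \<beta> D M x (Suc t) $ 1 - zeta \<beta> D M x (Suc t) $ 2
      = (zeta \<beta> D M x t $ 1 - zeta \<beta> D M x t $ 2) + x (Suc t) $ 1 / \<pi> 1 - x (Suc t) $ 2 / \<pi> 2"
    by (simp add: strategy)
  also have "\<dots> = sqrt (D * real M) * ?w + real M * (q 1 - q 2)
      + sqrt (D * real M) * (packet_sd \<beta> D q t 1 ?w * g (Suc t, 1) - packet_sd \<beta> D q t 2 ?w * g (Suc t, 2))"
    unfolding step using Suc by (simp add: right_diff_distrib)
  also have "\<dots> = sqrt (D * real M) * walk m (packet_sd \<beta> D q) g (Suc t)"
    unfolding m by (simp add: distrib_left right_diff_distrib)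
  finally show ?case .
qed simp

section \<open>Expected packet losses and the exact regret for finite \<open>M\<close>\<close>

lemma packet_loss_measurable [measurable]:
  "t < T \<Longrightarrow> packet_loss \<beta> D q M m t l \<in> borel_measurable (noise_space T)"
proof -
  assume t: "t < T"
  have [measurable]: "(\<lambda>g. walk m (packet_sd \<beta> D q) g t) \<in> borel_measurable (noise_space T)"
    using t by (intro walk_measurable packet_sd_measurable) auto
  have [measurable]: "(\<lambda>g. g (Suc t, l)) \<in> borel_measurable (noise_space T)"
    using t by (intro noise_component) auto
  show ?thesis unfolding packet_loss_def Let_def loss_mean_def loss_var_def by measurable
qed

text \<open>The coefficient of the fresh noise is determined by earlier packets, so only the
  conditional mean contributes.\<close>

lemma packet_loss_expectation:
  fixes q :: "2 \<Rightarrow> real"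
  assumes t: "t < T"
  shows "integrable (noise_space T) (packet_loss \<beta> D q M m t l)"
    and "(LINT g|noise_space T. packet_loss \<beta> D q M m t l g)
      = real M * q l * (LINT g|noise_space T. choice_prob \<beta> t l (walk m (packet_sd \<beta> D q) g t))"
proof -
  interpret prob_space "noise_space T" by (rule prob_space_noise_space)
  let ?w = "\<lambda>g. walk m (packet_sd \<beta> D q) g t"
  let ?\<pi> = "\<lambda>g. choice_prob \<beta> t l (?w g)"
  let ?s = "\<lambda>g. sqrt (loss_var (?\<pi> g) (q l) M)"
  have i: "(Suc t, l) \<in> {1..T} \<times> UNIV" using t by simp
  have [measurable]: "?w \<in> borel_measurable (noise_space T)"
    using t by (intro walk_measurable packet_sd_measurable) auto
  have g [measurable]: "(\<lambda>g. g (Suc t, l)) \<in> borel_measurable (noise_space T)"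
    by (rule noise_component[OF i])
  \<comment> \<open>For small \<open>M\<close> the value \<open>q l\<close> may leave
    \<open>[0, 1]\<close>, hence the absolute values. The real square root is odd, so
    \<open>\<bar>sqrt x\<bar> = sqrt \<bar>x\<bar>\<close> also covers a negative argument.\<close>
  define C where "C = sqrt (real M * \<bar>q l\<bar> * (1 + \<bar>q l\<bar>))"
  have bound: "\<bar>?s g\<bar> \<le> C" for g
  proof -
    define \<pi> where "\<pi> = ?\<pi> g"
    have \<pi>: "0 \<le> \<pi>" "\<pi> \<le> 1" by (simp_all add: \<pi>_def choice_prob_pos choice_prob_less_1 less_imp_le)
    have "\<pi> * \<bar>q l\<bar> \<le> 1 * \<bar>q l\<bar>" using \<pi> by (intro mult_right_mono) auto
    then have "\<bar>\<pi> * q l\<bar> \<le> \<bar>q l\<bar>" using \<pi> by (simp add: abs_mult)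
    then have "\<bar>\<pi> * q l * (1 - \<pi> * q l)\<bar> \<le> \<bar>q l\<bar> * (1 + \<bar>q l\<bar>)"
      unfolding abs_mult[of "\<pi> * q l"] by (intro mult_mono) auto
    then have "\<bar>loss_var \<pi> (q l) M\<bar> \<le> real M * (\<bar>q l\<bar> * (1 + \<bar>q l\<bar>))"
      unfolding loss_var_def by (simp add: abs_mult mult.assoc mult_left_mono)
    then show ?thesis unfolding \<pi>_def[symmetric] C_def real_sqrt_abs'[symmetric]
      by (simp only: mult.assoc real_sqrt_le_mono)
  qed
  have int_noise: "integrable (noise_space T) (\<lambda>g. ?s g * g (Suc t, l))"
  proof (rule Bochner_Integration.integrable_bound)
    show "integrable (noise_space T) (\<lambda>g. C * g (Suc t, l))"
      using integrable_gauss_power[of 1]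
      by (intro integrable_mult_right integrable_noise_component[OF i, where f = "\<lambda>x. x"]) simp
    show "(\<lambda>g. ?s g * g (Suc t, l)) \<in> borel_measurable (noise_space T)"
      unfolding loss_var_def by measurable
    show "AE g in noise_space T. norm (?s g * g (Suc t, l)) \<le> norm (C * g (Suc t, l))"
    proof (rule AE_I2)
      fix g
      have "\<bar>?s g\<bar> \<le> \<bar>C\<bar>" using bound[of g] by linarith
      then show "norm (?s g * g (Suc t, l)) \<le> norm (C * g (Suc t, l))"
        unfolding real_norm_def abs_mult by (rule mult_right_mono) simp
    qed
  qed
  have mean: "(LINT g|noise_space T. ?s g * g (Suc t, l)) = 0"
    by (rule noise_orthogonal[OF i int_noise]) (simp add: walk_fun_upd)
  have int_\<pi>: "integrable (noise_space T) ?\<pi>"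
    using t by (intro choice_prob_expectation_integrable packet_sd_measurable) auto
  have eq: "packet_loss \<beta> D q M m t l = (\<lambda>g. real M * q l * ?\<pi> g + ?s g * g (Suc t, l))"
    by (simp add: fun_eq_iff packet_loss_def loss_mean_def Let_def mult_ac)
  show "integrable (noise_space T) (packet_loss \<beta> D q M m t l)"
    unfolding eq by (intro Bochner_Integration.integrable_add integrable_mult_right int_\<pi> int_noise)
  show "(LINT g|noise_space T. packet_loss \<beta> D q M m t l g) = real M * q l * (LINT g|noise_space T. ?\<pi> g)"
    unfolding eq using int_\<pi> int_noise mean by simp
qed

text \<open>All fluctuations are collected in one random point \<open>G\<close> of the noise space,
  distributed as its measure. Expectations over \<open>P\<close> thereby become integrals over the
  common space.\<close>

lemma normal_losses_representation:
  assumes losses: "normal_losses \<beta> p d D T M P X"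
    and T: "1 \<le> T"
  obtains G where "G \<in> measurable P (noise_space T)" "distr P (noise_space T) G = noise_space T"
    "AE \<omega> in P. \<forall>t<T. \<forall>l. X (Suc t) \<omega> $ l
      = loss_mean (action_prob \<beta> D M (\<lambda>s. X s \<omega>) t $ l) (1 - arm_prob p d D (T * M) l) M
      + sqrt (loss_var (action_prob \<beta> D M (\<lambda>s. X s \<omega>) t $ l) (1 - arm_prob p d D (T * M) l) M)
        * G \<omega> (Suc t, l)"
proof -
  interpret prob_space P using losses by (simp add: normal_losses_def)
  let ?I = "{1..T} \<times> UNIV :: (nat \<times> 2) set"
  obtain \<eta> :: "nat \<Rightarrow> 2 \<Rightarrow> 'a \<Rightarrow> real" where
    indep: "indep_vars (\<lambda>_. borel) (\<lambda>(t, l). \<eta> t l) ?I"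
    and normal: "\<forall>t\<in>{1..T}. \<forall>l. distributed P lborel (\<eta> t l) std_normal_density"
    and X: "\<forall>t\<in>{1..T}. \<forall>l. AE \<omega> in P.
           let \<pi> = action_prob \<beta> D M (\<lambda>s. X s \<omega>) (t - 1) $ l;
               q = 1 - arm_prob p d D (T * M) l
           in X t \<omega> $ l = loss_mean \<pi> q M + sqrt (loss_var \<pi> q M) * \<eta> t l \<omega>"
    using losses unfolding normal_losses_def by (elim conjE exE) (rule that)
  define Y where "Y = (\<lambda>(t, l). \<eta> t l)"
  define G where "G = (\<lambda>\<omega>. \<lambda>i\<in>?I. Y i \<omega>)"
  have Y: "Y i \<in> borel_measurable P" "distr P borel (Y i) = gauss" if "i \<in> ?I" for i
  proof -
    obtain t l where i: "i = (t, l)" "t \<in> {1..T}" using \<open>i \<in> ?I\<close> by (cases i) auto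
    note dist = normal[rule_format, OF i(2), of l]
    show "Y i \<in> borel_measurable P" using distributed_measurable[OF dist] by (simp add: Y_def i)
    have "distr P borel (Y i) = distr P lborel (\<eta> t l)" by (rule distr_cong) (auto simp: Y_def i)
    also have "\<dots> = gauss" using distributed_distr_eq_density[OF dist] by (simp add: gauss_def)
    finally show "distr P borel (Y i) = gauss" .
  qed
  have sets: "sets (noise_space T) = sets (PiM ?I (\<lambda>_. borel))"
    unfolding noise_space_def by (rule sets_PiM_cong) auto
  \<comment> \<open>Independence means that the joint law is the product of the marginals; the index
    set is nonempty by \<open>T\<close>.\<close>
  have "distr P (PiM ?I (\<lambda>_. borel)) G = PiM ?I (\<lambda>i. distr P borel (Y i))"
    unfolding G_def using indep Y(1) T
    by (subst indep_vars_iff_distr_eq_PiM'[symmetric]) (auto simp: Y_def)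
  also have "\<dots> = noise_space T"
    unfolding noise_space_def using Y(2) by (intro PiM_cong) auto
  finally have distr: "distr P (PiM ?I (\<lambda>_. borel)) G = noise_space T" .
  show ?thesis
  proof (rule that)
    have "G \<in> measurable P (PiM ?I (\<lambda>_. borel))" unfolding G_def by (rule measurable_restrict) (rule Y(1))
    then show "G \<in> measurable P (noise_space T)" by (simp cong: measurable_cong_sets add: sets)
    show "distr P (noise_space T) G = noise_space T"
      using distr sets by (metis distr_cong)
    have "AE \<omega> in P. \<forall>t\<in>{..<T}. \<forall>l\<in>UNIV. X (Suc t) \<omega> $ l
      = loss_mean (action_prob \<beta> D M (\<lambda>s. X s \<omega>) t $ l) (1 - arm_prob p d D (T * M) l) M
      + sqrt (loss_var (action_prob \<beta> D M (\<lambda>s. X s \<omega>) t $ l) (1 - arm_prob p d D (T * M) l) M)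
        * G \<omega> (Suc t, l)"
    proof (intro AE_finite_allI finite_lessThan finite)
      fix t and l :: 2 assume "t \<in> {..<T}"
      then have "Suc t \<in> {1..T}" by auto
      from X[rule_format, OF this, of l] show "AE \<omega> in P. X (Suc t) \<omega> $ l
        = loss_mean (action_prob \<beta> D M (\<lambda>s. X s \<omega>) t $ l) (1 - arm_prob p d D (T * M) l) M
        + sqrt (loss_var (action_prob \<beta> D M (\<lambda>s. X s \<omega>) t $ l) (1 - arm_prob p d D (T * M) l) M)
          * G \<omega> (Suc t, l)"
        using \<open>Suc t \<in> {1..T}\<close> by (simp add: Let_def G_def Y_def)
    qed
    then show "AE \<omega> in P. \<forall>t<T. \<forall>l. X (Suc t) \<omega> $ l
      = loss_mean (action_prob \<beta> D M (\<lambda>s. X s \<omega>) t $ l) (1 - arm_prob p d D (T * M) l) M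
      + sqrt (loss_var (action_prob \<beta> D M (\<lambda>s. X s \<omega>) t $ l) (1 - arm_prob p d D (T * M) l) M)
        * G \<omega> (Suc t, l)"
      by eventually_elim simp
  qed
qed

text \<open>An exact identity for each nonempty packet size: \<open>M\<close> remains only in the
  failure probabilities inside \<open>packet_sd\<close>.\<close>

lemma normalized_regret_eq:
  assumes losses: "normal_losses \<beta> p d D T M P X"
    and T: "1 \<le> T" and M: "0 < M" and \<beta>: "0 < \<beta>" and d: "0 < d" and D: "0 < D"
  shows "normalized_regret p d D T M P X = 2 * d / real T * (\<Sum>t<T. LINT g|noise_space T.
    choice_prob \<beta> t 2 (walk (- 2 * d / sqrt (real T))
      (packet_sd \<beta> D (\<lambda>l. 1 - arm_prob p d D (T * M) l)) g t))"
proof -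
  interpret P: prob_space P using losses by (simp add: normal_losses_def)
  interpret N: prob_space "noise_space T" by (rule prob_space_noise_space)
  define m where "m = - 2 * d / sqrt (real T)"
  define q where "q l = 1 - arm_prob p d D (T * M) l" for l
  define w where "w g t = walk m (packet_sd \<beta> D q) g t" for g t
  define \<epsilon> where "\<epsilon> = d * sqrt (D / real (T * M))"
  define e where "e t = (LINT g|noise_space T. choice_prob \<beta> t 2 (w g t))" for t
  have \<epsilon>: "0 < \<epsilon>" using T M D d by (simp add: \<epsilon>_def)
  have q12: "q 1 = 1 - (p + \<epsilon>)" "q 2 = 1 - (p - \<epsilon>)" by (simp_all add: q_def arm_prob_def \<epsilon>_def)
  \<comment> \<open>The gap between the actions is of order \<open>1 / sqrt M\<close>, so over a
    packet it has the same order \<open>sqrt M\<close> as the noise; in these units the drift is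
    free of \<open>M\<close>.\<close>
  have "real M * sqrt (D / real (T * M)) = sqrt (D * real M) / sqrt (real T)"
  proof -
    have "real M * sqrt (D / real (T * M)) = sqrt ((real M)\<^sup>2 * (D / real (T * M)))"
      by (simp only: real_sqrt_mult[of "(real M)\<^sup>2"] real_sqrt_abs abs_of_nat)
    also have "(real M)\<^sup>2 * (D / real (T * M)) = D * real M / real T"
      using M by (simp add: power2_eq_square)
    finally show ?thesis by (simp add: real_sqrt_divide)
  qed
  moreover have "real M * (q 1 - q 2) = - 2 * d * (real M * sqrt (D / real (T * M)))"
    by (simp add: q12 \<epsilon>_def)
  ultimately have m: "real M * (q 1 - q 2) = sqrt (D * real M) * m"
    by (simp add: m_def)
  obtain G where G: "G \<in> measurable P (noise_space T)" and distr: "distr P (noise_space T) G = noise_space T"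
    and X: "AE \<omega> in P. \<forall>t<T. \<forall>l. X (Suc t) \<omega> $ l
      = loss_mean (action_prob \<beta> D M (\<lambda>s. X s \<omega>) t $ l) (q l) M
      + sqrt (loss_var (action_prob \<beta> D M (\<lambda>s. X s \<omega>) t $ l) (q l) M) * G \<omega> (Suc t, l)"
    unfolding q_def by (rule normal_losses_representation[OF losses T])
  let ?L = "packet_loss \<beta> D q M m"
  let ?income = "\<lambda>g. \<Sum>t<T. real M - (?L t 1 g + ?L t 2 g)"
  have [measurable]: "?income \<in> borel_measurable (noise_space T)"
    by (intro borel_measurable_sum borel_measurable_diff borel_measurable_const borel_measurable_add
        packet_loss_measurable) auto
  have total: "total_income T M X \<omega> = (\<Sum>t<T. real M - (X (Suc t) \<omega> $ 1 + X (Suc t) \<omega> $ 2))" for \<omega>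
    unfolding total_income_def by (rule sum.reindex_bij_witness[of _ Suc "\<lambda>t. t - 1"]) auto
  have X_meas: "X t \<in> borel_measurable P" if "t \<in> {1..T}" for t
    using losses that by (simp add: normal_losses_def)
  have "(LINT \<omega>|P. total_income T M X \<omega>) = (LINT \<omega>|P. ?income (G \<omega>))"
  proof (rule integral_cong_AE)
    have "(\<lambda>\<omega>. X (Suc t) \<omega> $ l) \<in> borel_measurable P" if "t < T" for t l
      using measurable_compose[OF X_meas borel_measurable_nth] that by simp
    then show "total_income T M X \<in> borel_measurable P"
      unfolding total by (intro borel_measurable_sum borel_measurable_diff borel_measurable_const borel_measurable_add) auto
    show "(\<lambda>\<omega>. ?income (G \<omega>)) \<in> borel_measurable P"
      by (rule measurable_compose[OF G]) measurable
    show "AE \<omega> in P. total_income T M X \<omega> = ?income (G \<omega>)"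
      using X
    proof eventually_elim
      case (elim \<omega>)
      have "X (Suc t) \<omega> $ l = ?L t l (G \<omega>)" if "t < T" for t l
      proof -
        have "action_prob \<beta> D M (\<lambda>s. X s \<omega>) t $ l = choice_prob \<beta> t l (walk m (packet_sd \<beta> D q) (G \<omega>) t)"
          unfolding action_prob_def
          using elim that
          by (intro strategy_eq_choice_prob zeta_diff_eq_walk[OF \<beta> D M m, where T = T] \<beta> D M) auto
        then show ?thesis using elim that by (simp add: packet_loss_def Let_def)
      qed
      then show ?case unfolding total by (intro sum.cong) auto
    qed
  qed
  also have "\<dots> = (LINT g|noise_space T. ?income g)"
    using integral_distr[OF G, of ?income] by (simp add: distr)
  also have "\<dots> = (\<Sum>t<T. real M - ((LINT g|noise_space T. ?L t 1 g) + (LINT g|noise_space T. ?L t 2 g)))"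
    using packet_loss_expectation(1)[of _ T \<beta> D q M m] by (simp add: N.prob_space)
  \<comment> \<open>Each item given to the second action costs the gap \<open>2 * \<epsilon>\<close>
    against the better first action.\<close>
  also have "\<dots> = (\<Sum>t<T. real M * (p + \<epsilon>) - 2 * real M * \<epsilon> * e t)"
  proof (rule sum.cong)
    fix t assume "t \<in> {..<T}"
    then have t: "t < T" by simp
    have "choice_prob \<beta> t 1 v = 1 - choice_prob \<beta> t 2 v" for v using choice_prob_2[of \<beta> t v] by simp
    moreover have "integrable (noise_space T) (\<lambda>g. choice_prob \<beta> t 2 (w g t))"
      unfolding w_def using t by (intro choice_prob_expectation_integrable packet_sd_measurable) auto
    ultimately have e1: "(LINT g|noise_space T. choice_prob \<beta> t 1 (w g t)) = 1 - e t"
      by (simp add: e_def N.prob_space)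
    show "real M - ((LINT g|noise_space T. ?L t 1 g) + (LINT g|noise_space T. ?L t 2 g))
        = real M * (p + \<epsilon>) - 2 * real M * \<epsilon> * e t"
      unfolding packet_loss_expectation(2)[OF t] w_def[symmetric] e1 e_def[symmetric] q12
      by (simp add: algebra_simps)
  qed simp
  also have "\<dots> = real (T * M) * (p + \<epsilon>) - 2 * real M * \<epsilon> * (\<Sum>t<T. e t)"
    by (simp add: sum_subtractf sum_distrib_left)
  finally have income: "(LINT \<omega>|P. total_income T M X \<omega>) = real (T * M) * (p + \<epsilon>) - 2 * real M * \<epsilon> * (\<Sum>t<T. e t)" .
  have "max (arm_prob p d D (T * M) 1) (arm_prob p d D (T * M) 2) = p + \<epsilon>"
    using \<epsilon> by (simp add: arm_prob_def \<epsilon>_def)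
  then have "normalized_regret p d D T M P X = 2 * real M * \<epsilon> / sqrt (D * real (T * M)) * (\<Sum>t<T. e t)"
    unfolding normalized_regret_def regret_def income by simp
  \<comment> \<open>The two square roots combine to \<open>1 / (T * M)\<close>, which cancels the
    packet size.\<close>
  also have "2 * real M * \<epsilon> / sqrt (D * real (T * M)) = 2 * d / real T"
  proof -
    have "sqrt (D / real (T * M)) / sqrt (D * real (T * M)) = sqrt (D / real (T * M) / (D * real (T * M)))"
      by (simp only: real_sqrt_divide)
    also have "D / real (T * M) / (D * real (T * M)) = (1 / real (T * M))\<^sup>2"
      using D by (simp add: power2_eq_square)
    also have "sqrt \<dots> = 1 / real (T * M)" by (rule real_sqrt_unique) auto
    finally have "2 * real M * \<epsilon> / sqrt (D * real (T * M)) = 2 * real M * d * (1 / real (T * M))"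
      unfolding \<epsilon>_def by (simp add: mult.assoc flip: times_divide_eq_right)
    then show ?thesis using M by simp
  qed
  finally show ?thesis by (simp only: e_def w_def m_def q_def[abs_def])
qed

text \<open>With \<open>T\<close> fixed, \<open>N\<close> tends to infinity exactly when
  \<open>M\<close> does. Both failure probabilities tend to \<open>1 - p\<close>, while the drift
  stays fixed.\<close>

lemma normalized_regret_tendsto:
  assumes losses: "\<forall>\<^sub>F M in sequentially. normal_losses \<beta> p d D T M (P M) (X M)"
    and T: "1 \<le> T" and \<beta>: "0 < \<beta>" and d: "0 < d" and D: "0 < D"
  shows "(\<lambda>M. normalized_regret p d D T M (P M) (X M)) \<longlonglongrightarrow> limit_loss \<beta> d (1 - p) D T"
proof -
  let ?m = "- 2 * d / sqrt (real T)"
  let ?q = "\<lambda>M l. 1 - arm_prob p d D (T * M) l"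
  have "(\<lambda>M. D / real (T * M)) \<longlonglongrightarrow> 0"
    using tendsto_mult[OF tendsto_const[of "D / real T"] lim_1_over_n] by simp
  from tendsto_real_sqrt[OF this] have "(\<lambda>M. sqrt (D / real (T * M))) \<longlonglongrightarrow> 0" by simp
  note tendsto_mult[OF tendsto_const[of d] this]
  then have "(\<lambda>M. 1 - (p + d * sqrt (D / real (T * M)))) \<longlonglongrightarrow> 1 - (p + d * 0)"
    "(\<lambda>M. 1 - (p - d * sqrt (D / real (T * M)))) \<longlonglongrightarrow> 1 - (p - d * 0)"
    by (intro tendsto_diff tendsto_add tendsto_const; assumption)+
  then have q: "(\<lambda>M. ?q M l) \<longlonglongrightarrow> 1 - p" for l
    by (cases "l = 1") (simp_all add: arm_prob_def)
  have conv: "(\<lambda>M. packet_sd \<beta> D (?q M) j l (x M)) \<longlonglongrightarrow> packet_sd \<beta> D (\<lambda>_. 1 - p) j l v"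
    if "x \<longlonglongrightarrow> v" for j l v x
    unfolding packet_sd_def using choice_prob_pos[of \<beta> j l v] D
    by (intro tendsto_real_sqrt tendsto_divide tendsto_mult tendsto_diff tendsto_const q
        choice_prob_tendsto that) simp
  have "(\<lambda>M. LINT g|noise_space T. choice_prob \<beta> t 2 (walk ?m (packet_sd \<beta> D (?q M)) g t))
      \<longlonglongrightarrow> (LINT g|noise_space T. choice_prob \<beta> t 2 (walk ?m (packet_sd \<beta> D (\<lambda>_. 1 - p)) g t))"
    if "t < T" for t
    using that by (intro noise_expectation_tendsto[where B = 1] choice_prob_continuous
        abs_choice_prob_le_1 conv packet_sd_measurable) auto
  then have "(\<lambda>M. 2 * d / real T * (\<Sum>t<T. LINT g|noise_space T.
      choice_prob \<beta> t 2 (walk ?m (packet_sd \<beta> D (?q M)) g t))) \<longlonglongrightarrow> limit_loss \<beta> d (1 - p) D T"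
    unfolding limit_loss_def by (intro tendsto_mult tendsto_const tendsto_sum) auto
  \<comment> \<open>The exact formula applies at every positive \<open>M\<close> where the normality
    assumption holds.\<close>
  moreover have "\<forall>\<^sub>F M in sequentially. 2 * d / real T * (\<Sum>t<T. LINT g|noise_space T.
      choice_prob \<beta> t 2 (walk ?m (packet_sd \<beta> D (?q M)) g t)) = normalized_regret p d D T M (P M) (X M)"
    using losses eventually_gt_at_top[of 0]
    by eventually_elim (rule normalized_regret_eq[OF _ T _ \<beta> d D, symmetric])
  ultimately show ?thesis by (rule Lim_transform_eventually)
qed

text \<open>Choosing \<open>\<Lambda>\<close> before all parameters, measures and losses expresses
  that the limit is determined by \<open>\<beta>\<close>, \<open>d\<close>, \<open>q\<close>,
  \<open>D\<close> and \<open>T\<close>. Dependence on \<open>q\<close> and \<open>D\<close> is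
  claimed from \<open>T = 2\<close> on, since a single packet is played uniformly and always loses
  \<open>d\<close>.\<close>

theorem theorem5:
  "\<exists>\<Lambda> :: real \<Rightarrow> real \<Rightarrow> real \<Rightarrow> real \<Rightarrow> nat \<Rightarrow> real.
     (\<forall>(T::nat) \<beta> p d D (P :: nat \<Rightarrow> 'a measure) (X :: nat \<Rightarrow> nat \<Rightarrow> 'a \<Rightarrow> real^2).
        T \<ge> 1 \<longrightarrow> \<beta> > 0 \<longrightarrow> 0 < p \<longrightarrow> p < 1 \<longrightarrow> d > 0 \<longrightarrow> D > 0 \<longrightarrow>
        (\<forall>\<^sub>F M in sequentially. normal_losses \<beta> p d D T M (P M) (X M)) \<longrightarrow>
        (\<lambda>M. normalized_regret p d D T M (P M) (X M)) \<longlonglongrightarrow> \<Lambda> \<beta> d (1 - p) D T)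
   \<and> (\<forall>T\<ge>2. \<forall>\<beta>>0. \<forall>d>0. \<forall>D>0. \<exists>q\<in>{0<..<1}. \<exists>q'\<in>{0<..<1}. \<Lambda> \<beta> d q D T \<noteq> \<Lambda> \<beta> d q' D T)
   \<and> (\<forall>T\<ge>2. \<forall>\<beta>>0. \<forall>d>0. \<forall>q\<in>{0<..<1}. \<exists>D>0. \<exists>D'>0. \<Lambda> \<beta> d q D T \<noteq> \<Lambda> \<beta> d q D' T)
   \<and> (\<forall>\<beta>>0. \<forall>d>0. \<forall>q\<in>{0<..<1}. \<forall>D>0. \<exists>T\<ge>1. \<exists>T'\<ge>1. \<Lambda> \<beta> d q D T \<noteq> \<Lambda> \<beta> d q D T')"
proof (intro exI[of _ limit_loss] conjI allI impI ballI)
  show "\<exists>T\<ge>1. \<exists>T'\<ge>1. limit_loss \<beta> d q D T \<noteq> limit_loss \<beta> d q D T'"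
    if "0 < \<beta>" "0 < d" for \<beta> d q D
    using limit_loss_depends_on_T[OF that, of q D]
    by (intro exI[of _ 2] exI[of _ 1] conjI) auto
qed (auto intro!: normalized_regret_tendsto limit_loss_depends_on_q limit_loss_depends_on_D)

end
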